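(* Let $(M,g)$ be a non-trapping Riemannian surface with strictly convex boundary, let $a\in C^\infty(M)$, let $m\ge0$ be an integer, and suppose that $I_{a,k}$ is s-injective for all $0\le k\le m$. Then for any $m$-tensor field $f\in C^\infty(S^m(T^*M))$, the collection of moment ray transforms $$I_a[\tau^k\,\ell_mf],\qquad 0\le k\le m,$$ determines $f$ uniquely and explicitly; here uniqueness means that if $f,f'\in C^\infty(S^m(T^*M))$ satisfy $I_a[\tau^k\ell_mf]=I_a[\tau^k\ell_mf']$ on $\partial_+SM$ for all $0\le k\le m$, then $f=f'$.
   Context: $M$ is compact with smooth boundary $\partial M$; non-trapping means that every geodesic reaches $\partial M$ in finite time. $SM$ is the unit tangent bundle, $\partial SM$ its restriction over $\partial M$, and $\partial_+SM=\{(x,v)\in SM:x\in\partial M,\ \langle v,\nu(x)\rangle\le0\}$ with $\nu$ the outer unit normal. $\varphi_t$ is the geodesic flow, $X$ its generator, $\gamma_{x,v}$ the geodesic with initial data $(x,v)$, and $\tau(x,v)$ the first time at which it hits $\partial M$. $S^m(T^*M)$ is the bundle of symmetric $m$-tensors, $C^\infty(S^m(T^*M))$ its smooth (complex-valued) sections, and $\ell_mf(x,v)=f_x(v,\dots,v)$ for $(x,v)\in SM$. The attenuated ray transform of $F:SM\to\mathbb{C}$ is $$I_aF(x,v)=\int_0^{\tau(x,v)}w_a(\varphi_t(x,v))F(\varphi_t(x,v))\,dt,\qquad (x,v)\in\partial_+SM,$$ $$w_a(x,v)=\exp\Big(-\int_0^{\tau(x,v)}a(\gamma_{x,v}(s))\,ds\Big).$$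 In $I_a[\tau^k\ell_mf]$ the integrand is the function $(x,v)\mapsto\tau(x,v)^k\,\ell_mf(x,v)$ on $SM$. A function of degree $k$ on $SM$ is a smooth function on $SM$ whose Fourier expansion in the fiber (circle) variable only involves harmonics $j$ with $|j|\le k$ (degree $-1$ means zero). s-injectivity of $I_{a,k}$ (tensor tomography at order $k$, where, since attenuation mixes even and odd harmonics, $k$-tensors are replaced by functions of degree $k$) means that the natural kernel is the only obstruction to injectivity: whenever $F$ is a function of degree $k$ on $SM$ with $I_aF=0$, there is a function $p$ of degree $k-1$ with $p|_{\partial SM}=0$ and $F=(X+a)p$. The word "explicitly" is an informal indication that $f$ can be recovered constructively from the data; it carries no further precise content in the statement. *)

theory Defs
  imports "HOL-Analysis.Analysis"
begin

section \<open>Smooth maps on subsets of Euclidean spaces\<close>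

fun Ck_on :: "nat \<Rightarrow> 'e::euclidean_space set \<Rightarrow> ('e \<Rightarrow> 'f::real_normed_vector) \<Rightarrow> bool" where
  "Ck_on 0 U h \<longleftrightarrow> continuous_on U h"
| "Ck_on (Suc n) U h \<longleftrightarrow>
     h differentiable_on U \<and> (\<forall>v. Ck_on n U (\<lambda>x. frechet_derivative h (at x) v))"

text \<open>On a set that need not be open (here: a piece of the closed half plane, or of the unit
  sphere bundle), smoothness means having local smooth extensions to open sets.\<close>

definition smooth_on :: "'e::euclidean_space set \<Rightarrow> ('e \<Rightarrow> 'f::real_normed_vector) \<Rightarrow> bool" where
  "smooth_on D h \<longleftrightarrow>
     (\<forall>x\<in>D. \<exists>U k. open U \<and> x \<in> U \<and> (\<forall>n. Ck_on n U k) \<and> (\<forall>y\<in>D \<inter> U. k y = h y))"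


section \<open>Compact Riemannian surfaces with boundary\<close>

definition half_plane :: "(real^2) set" where
  "half_plane = {y. 0 \<le> y $ 2}"

text \<open>A chart is a pair of a domain and a coordinate map.  A tangent vector at \<open>x\<close> is represented
  by the family of its coordinates in all the charts around \<open>x\<close> (and \<open>0\<close> for all the other
  charts), transforming by the derivatives of the transition maps.\<close>

type_synonym 'a chart = "'a set \<times> ('a \<Rightarrow> real^2)"
type_synonym 'a tvec = "'a chart \<Rightarrow> real^2"

record 'a surface =
  space_of :: "'a topology"
  atlas :: "'a chart set"
  metric :: "'a \<Rightarrow> 'a tvec \<Rightarrow> 'a tvec \<Rightarrow> real"

abbreviation points :: "'a surface \<Rightarrow> 'a set" where
  "points S \<equiv> topspace (space_of S)"

definition cdom :: "'a chart \<Rightarrow> (real^2) set" where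
  "cdom c = snd c ` fst c"

definition cpoint :: "'a chart \<Rightarrow> real^2 \<Rightarrow> 'a" where
  "cpoint c = inv_into (fst c) (snd c)"

definition charts_at :: "'a surface \<Rightarrow> 'a \<Rightarrow> 'a chart set" where
  "charts_at S x = {c \<in> atlas S. x \<in> fst c}"

definition smooth_surface :: "'a surface \<Rightarrow> bool" where
  "smooth_surface S \<longleftrightarrow>
     Hausdorff_space (space_of S) \<and> second_countable (space_of S) \<and>
     (\<Union>c\<in>atlas S. fst c) = points S \<and>
     (\<forall>c\<in>atlas S. openin (space_of S) (fst c) \<and> openin (top_of_set half_plane) (cdom c) \<and>
        homeomorphic_map (subtopology (space_of S) (fst c)) (top_of_set (cdom c)) (snd c)) \<and>
     (\<forall>c\<in>atlas S. \<forall>d\<in>atlas S. smooth_on (snd c ` (fst c \<inter> fst d)) (snd d \<circ> cpoint c))"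

definition transition_deriv :: "'a chart \<Rightarrow> 'a chart \<Rightarrow> 'a \<Rightarrow> real^2 \<Rightarrow> real^2" where
  "transition_deriv c d x =
     frechet_derivative (snd d \<circ> cpoint c) (at (snd c x) within snd c ` (fst c \<inter> fst d))"

definition tangent_space :: "'a surface \<Rightarrow> 'a \<Rightarrow> 'a tvec set" where
  "tangent_space S x =
     {v. (\<forall>c\<in>charts_at S x. \<forall>d\<in>charts_at S x. v d = transition_deriv c d x (v c)) \<and>
         (\<forall>c. c \<notin> charts_at S x \<longrightarrow> v c = 0)}"

definition tcomb :: "real \<Rightarrow> 'a tvec \<Rightarrow> real \<Rightarrow> 'a tvec \<Rightarrow> 'a tvec" where
  "tcomb r v s w = (\<lambda>c. r *\<^sub>R v c + s *\<^sub>R w c)"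

text \<open>The tangent vector at \<open>x\<close> whose coordinates in the chart \<open>c\<close> are \<open>\<eta>\<close>.\<close>

definition tvec_of :: "'a surface \<Rightarrow> 'a chart \<Rightarrow> 'a \<Rightarrow> real^2 \<Rightarrow> 'a tvec" where
  "tvec_of S c x \<eta> = (\<lambda>d. if d \<in> charts_at S x then transition_deriv c d x \<eta> else 0)"

definition coord_field :: "'a surface \<Rightarrow> 'a chart \<Rightarrow> 2 \<Rightarrow> real^2 \<Rightarrow> 'a tvec" where
  "coord_field S c i y = tvec_of S c (cpoint c y) (axis i 1)"

definition metric_coeff :: "'a surface \<Rightarrow> 'a chart \<Rightarrow> 2 \<Rightarrow> 2 \<Rightarrow> real^2 \<Rightarrow> real" where
  "metric_coeff S c i j y = metric S (cpoint c y) (coord_field S c i y) (coord_field S c j y)"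

definition riemannian_metric :: "'a surface \<Rightarrow> bool" where
  "riemannian_metric S \<longleftrightarrow>
     (\<forall>x\<in>points S. \<forall>u\<in>tangent_space S x. \<forall>v\<in>tangent_space S x.
        metric S x u v = metric S x v u \<and>
        (\<forall>w\<in>tangent_space S x. \<forall>r s.
           metric S x (tcomb r u s v) w = r * metric S x u w + s * metric S x v w)) \<and>
     (\<forall>x\<in>points S. \<forall>v\<in>tangent_space S x. v \<noteq> (\<lambda>_. 0) \<longrightarrow> 0 < metric S x v v) \<and>
     (\<forall>c\<in>atlas S. \<forall>i j. smooth_on (cdom c) (metric_coeff S c i j))"

definition compact_riemannian_surface :: "'a surface \<Rightarrow> bool" where
  "compact_riemannian_surface S \<longleftrightarrow>
     smooth_surface S \<and> compact_space (space_of S) \<and> riemannian_metric S"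

definition smooth_fun :: "'a surface \<Rightarrow> ('a \<Rightarrow> complex) \<Rightarrow> bool" where
  "smooth_fun S h \<longleftrightarrow> (\<forall>c\<in>atlas S. smooth_on (cdom c) (h \<circ> cpoint c))"

text \<open>A tensor field of rank \<open>m\<close> takes lists of \<open>m\<close> tangent vectors as arguments; it is set to \<open>0\<close>
  off its natural domain so that equality of fields is equality of functions.\<close>

definition sym_tensor_field :: "'a surface \<Rightarrow> nat \<Rightarrow> ('a \<Rightarrow> 'a tvec list \<Rightarrow> complex) \<Rightarrow> bool" where
  "sym_tensor_field S m f \<longleftrightarrow>
     (\<forall>x vs. \<not> (x \<in> points S \<and> length vs = m \<and> set vs \<subseteq> tangent_space S x) \<longrightarrow> f x vs = 0) \<and>
     (\<forall>x\<in>points S. \<forall>vs. length vs = m \<and> set vs \<subseteq> tangent_space S x \<longrightarrow>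
        (\<forall>i<m. \<forall>v\<in>tangent_space S x. \<forall>w\<in>tangent_space S x. \<forall>r s.
           f x (vs[i := tcomb r v s w]) =
             complex_of_real r * f x (vs[i := v]) + complex_of_real s * f x (vs[i := w])) \<and>
        (\<forall>ws. mset ws = mset vs \<longrightarrow> f x ws = f x vs)) \<and>
     (\<forall>c\<in>atlas S. \<forall>js. length js = m \<longrightarrow>
        smooth_on (cdom c) (\<lambda>y. f (cpoint c y) (map (\<lambda>i. coord_field S c i y) js)))"


section \<open>The unit tangent bundle and functions of finite degree\<close>

definition unit_bundle :: "'a surface \<Rightarrow> ('a \<times> 'a tvec) set" where
  "unit_bundle S = {(x, v). x \<in> points S \<and> v \<in> tangent_space S x \<and> metric S x v v = 1}"

definition bundle_point :: "'a surface \<Rightarrow> 'a chart \<Rightarrow> (real^2) \<times> (real^2) \<Rightarrow> 'a \<times> 'a tvec" where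
  "bundle_point S c = (\<lambda>(y, \<eta>). (cpoint c y, tvec_of S c (cpoint c y) \<eta>))"

definition smooth_bundle_fun :: "'a surface \<Rightarrow> ('a \<times> 'a tvec \<Rightarrow> complex) \<Rightarrow> bool" where
  "smooth_bundle_fun S F \<longleftrightarrow>
     (\<forall>c\<in>atlas S. smooth_on {(y, \<eta>). y \<in> cdom c \<and> bundle_point S c (y, \<eta>) \<in> unit_bundle S}
        (F \<circ> bundle_point S c))"

definition orthonormal_frame :: "'a surface \<Rightarrow> 'a \<Rightarrow> 'a tvec \<Rightarrow> 'a tvec \<Rightarrow> bool" where
  "orthonormal_frame S x e1 e2 \<longleftrightarrow>
     e1 \<in> tangent_space S x \<and> e2 \<in> tangent_space S x \<and>
     metric S x e1 e1 = 1 \<and> metric S x e2 e2 = 1 \<and> metric S x e1 e2 = 0"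

definition fiber_coeff ::
  "('a \<times> 'a tvec \<Rightarrow> complex) \<Rightarrow> 'a \<Rightarrow> 'a tvec \<Rightarrow> 'a tvec \<Rightarrow> int \<Rightarrow> complex" where
  "fiber_coeff F x e1 e2 j =
     integral {0..2*pi} (\<lambda>\<theta>. F (x, tcomb (cos \<theta>) e1 (sin \<theta>) e2) * cis (- (of_int j * \<theta>)))
       / complex_of_real (2 * pi)"

text \<open>The condition does not depend on the frame: a rotation multiplies the \<open>j\<close>-th harmonic by a
  constant, and a reflection exchanges the harmonics \<open>j\<close> and \<open>-j\<close>.  For \<open>k = -1\<close> the sum is empty.\<close>

definition degree_on_fibers :: "'a surface \<Rightarrow> int \<Rightarrow> ('a \<times> 'a tvec \<Rightarrow> complex) \<Rightarrow> bool" where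
  "degree_on_fibers S k F \<longleftrightarrow>
     smooth_bundle_fun S F \<and>
     (\<forall>x\<in>points S. \<forall>e1 e2 \<theta>. orthonormal_frame S x e1 e2 \<longrightarrow>
        F (x, tcomb (cos \<theta>) e1 (sin \<theta>) e2) =
          (\<Sum>j\<in>{-k..k}. fiber_coeff F x e1 e2 j * cis (of_int j * \<theta>)))"

definition ell :: "nat \<Rightarrow> ('a \<Rightarrow> 'a tvec list \<Rightarrow> complex) \<Rightarrow> 'a \<times> 'a tvec \<Rightarrow> complex" where
  "ell m f = (\<lambda>(x, v). f x (replicate m v))"


section \<open>Geodesics\<close>

definition metric_matrix :: "'a surface \<Rightarrow> 'a chart \<Rightarrow> real^2 \<Rightarrow> real^2^2" where
  "metric_matrix S c y = (\<chi> i j. metric_coeff S c i j y)"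

definition metric_coeff_deriv ::
  "'a surface \<Rightarrow> 'a chart \<Rightarrow> 2 \<Rightarrow> 2 \<Rightarrow> 2 \<Rightarrow> real^2 \<Rightarrow> real" where
  "metric_coeff_deriv S c l i j y =
     frechet_derivative (metric_coeff S c i j) (at y within cdom c) (axis l 1)"

definition christoffel :: "'a surface \<Rightarrow> 'a chart \<Rightarrow> real^2 \<Rightarrow> 2 \<Rightarrow> 2 \<Rightarrow> 2 \<Rightarrow> real" where
  "christoffel S c y k i j =
     (\<Sum>l\<in>UNIV. matrix_inv (metric_matrix S c y) $ k $ l *
        (metric_coeff_deriv S c i j l y + metric_coeff_deriv S c j i l y
          - metric_coeff_deriv S c l i j y)) / 2"

definition christoffel_form ::
  "'a surface \<Rightarrow> 'a chart \<Rightarrow> real^2 \<Rightarrow> real^2 \<Rightarrow> real^2 \<Rightarrow> real^2" where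
  "christoffel_form S c y \<eta> \<zeta> =
     (\<chi> k. \<Sum>i\<in>UNIV. \<Sum>j\<in>UNIV. christoffel S c y k i j * \<eta> $ i * \<zeta> $ j)"

text \<open>A geodesic on \<open>[0, T]\<close>, given together with its velocity: \<open>\<zeta> t = (\<gamma> t, \<gamma>' t)\<close>.  Carrying the
  velocity along makes the initial data meaningful for \<open>T = 0\<close> as well; all derivatives are
  one-sided at the endpoints.\<close>

definition geodesic :: "'a surface \<Rightarrow> real \<Rightarrow> (real \<Rightarrow> 'a \<times> 'a tvec) \<Rightarrow> bool" where
  "geodesic S T \<zeta> \<longleftrightarrow>
     0 \<le> T \<and> continuous_map (top_of_set {0..T}) (space_of S) (fst \<circ> \<zeta>) \<and>
     (\<forall>t\<in>{0..T}. snd (\<zeta> t) \<in> tangent_space S (fst (\<zeta> t)) \<and>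
        (\<forall>c\<in>charts_at S (fst (\<zeta> t)).
           ((\<lambda>s. snd c (fst (\<zeta> s))) has_vector_derivative snd (\<zeta> t) c) (at t within {0..T}) \<and>
           ((\<lambda>s. snd (\<zeta> s) c) has_vector_derivative
              - christoffel_form S c (snd c (fst (\<zeta> t))) (snd (\<zeta> t) c) (snd (\<zeta> t) c))
             (at t within {0..T})))"

definition geodesic_flow :: "'a surface \<Rightarrow> real \<Rightarrow> 'a \<times> 'a tvec \<Rightarrow> 'a \<times> 'a tvec" where
  "geodesic_flow S t \<xi> = (THE z. \<exists>\<zeta>. geodesic S t \<zeta> \<and> \<zeta> 0 = \<xi> \<and> \<zeta> t = z)"

text \<open>The generator of the geodesic flow.  A geodesic starting tangentially to a strictly convex
  boundary stays in the surface neither forwards nor backwards, so at such points \<open>X F\<close> is not a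
  derivative along a geodesic in the surface.  Hence \<open>X\<close> is written as the vector field
  \<open>\<eta>\<^sup>i \<partial>/\<partial>y\<^sup>i - \<Gamma>\<^sup>k\<^sub>i\<^sub>j \<eta>\<^sup>i \<eta>\<^sup>j \<partial>/\<partial>\<eta>\<^sup>k\<close>.  As this is tangent to the unit bundle, any extension of \<open>F\<close>
  to nonzero tangent vectors may be used; we take the one homogeneous of degree \<open>0\<close>.  The choice of
  the chart is immaterial.\<close>

definition chart_at :: "'a surface \<Rightarrow> 'a \<Rightarrow> 'a chart" where
  "chart_at S x = (SOME c. c \<in> charts_at S x)"

definition normalize_tvec :: "'a surface \<Rightarrow> 'a \<times> 'a tvec \<Rightarrow> 'a \<times> 'a tvec" where
  "normalize_tvec S = (\<lambda>(x, v). (x, \<lambda>c. v c /\<^sub>R sqrt (metric S x v v)))"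

definition geodesic_generator ::
  "'a surface \<Rightarrow> ('a \<times> 'a tvec \<Rightarrow> complex) \<Rightarrow> 'a \<times> 'a tvec \<Rightarrow> complex" where
  "geodesic_generator S F = (\<lambda>(x, v). let c = chart_at S x in
     frechet_derivative (F \<circ> normalize_tvec S \<circ> bundle_point S c)
       (at (snd c x, v c) within (cdom c \<times> (- {0})))
       (v c, - christoffel_form S c (snd c x) (v c) (v c)))"


section \<open>The boundary\<close>

definition boundary :: "'a surface \<Rightarrow> 'a set" where
  "boundary S = {x \<in> points S. \<exists>c\<in>charts_at S x. snd c x $ 2 = 0}"

definition boundary_tangent_space :: "'a surface \<Rightarrow> 'a \<Rightarrow> 'a tvec set" where
  "boundary_tangent_space S x = {v \<in> tangent_space S x. \<forall>c\<in>charts_at S x. v c $ 2 = 0}"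

definition outer_normal :: "'a surface \<Rightarrow> 'a \<Rightarrow> 'a tvec" where
  "outer_normal S x = (THE n. n \<in> tangent_space S x \<and> metric S x n n = 1 \<and>
     (\<forall>w\<in>boundary_tangent_space S x. metric S x n w = 0) \<and>
     (\<forall>c\<in>charts_at S x. n c $ 2 < 0))"

text \<open>The covariant derivative of the outer normal in a direction \<open>w\<close> tangent to the boundary; since
  \<open>w c $ 2 = 0\<close>, the coordinate line below runs inside the boundary.\<close>

definition normal_cov_deriv :: "'a surface \<Rightarrow> 'a \<Rightarrow> 'a tvec \<Rightarrow> 'a tvec" where
  "normal_cov_deriv S x w = (let c = chart_at S x in
     tvec_of S c x
       (vector_derivative (\<lambda>s. outer_normal S (cpoint c (snd c x + s *\<^sub>R w c)) c) (at 0)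
        + christoffel_form S c (snd c x) (w c) (outer_normal S x c)))"

definition strictly_convex_boundary :: "'a surface \<Rightarrow> bool" where
  "strictly_convex_boundary S \<longleftrightarrow>
     (\<forall>x\<in>boundary S. \<forall>w\<in>boundary_tangent_space S x. w \<noteq> (\<lambda>_. 0) \<longrightarrow>
        0 < metric S x (normal_cov_deriv S x w) w)"

definition boundary_bundle :: "'a surface \<Rightarrow> ('a \<times> 'a tvec) set" where
  "boundary_bundle S = {(x, v) \<in> unit_bundle S. x \<in> boundary S}"

definition influx_bundle :: "'a surface \<Rightarrow> ('a \<times> 'a tvec) set" where
  "influx_bundle S = {(x, v) \<in> boundary_bundle S. metric S x v (outer_normal S x) \<le> 0}"

definition nontrapping :: "'a surface \<Rightarrow> bool" where
  "nontrapping S \<longleftrightarrow>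
     (\<forall>\<xi>\<in>unit_bundle S. \<exists>T \<zeta>. geodesic S T \<zeta> \<and> \<zeta> 0 = \<xi> \<and> fst (\<zeta> T) \<in> boundary S)"

text \<open>For a geodesic that starts on the boundary, the starting time is not counted as a hitting time.
  If it leaves the surface at once (tangential and outward directions), its travel time is \<open>0\<close>.\<close>

definition hitting_times :: "'a surface \<Rightarrow> 'a \<times> 'a tvec \<Rightarrow> real set" where
  "hitting_times S \<xi> = {t. 0 < t \<and> (\<exists>\<zeta>. geodesic S t \<zeta> \<and> \<zeta> 0 = \<xi> \<and> fst (\<zeta> t) \<in> boundary S)}"

definition travel_time :: "'a surface \<Rightarrow> 'a \<times> 'a tvec \<Rightarrow> real" where
  "travel_time S \<xi> = (if hitting_times S \<xi> = {} then 0 else Inf (hitting_times S \<xi>))"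


section \<open>The attenuated ray transform\<close>

definition weight :: "'a surface \<Rightarrow> ('a \<Rightarrow> complex) \<Rightarrow> 'a \<times> 'a tvec \<Rightarrow> complex" where
  "weight S a \<xi> = exp (- integral {0..travel_time S \<xi>} (\<lambda>s. a (fst (geodesic_flow S s \<xi>))))"

definition ray_transform ::
  "'a surface \<Rightarrow> ('a \<Rightarrow> complex) \<Rightarrow> ('a \<times> 'a tvec \<Rightarrow> complex) \<Rightarrow> 'a \<times> 'a tvec \<Rightarrow> complex" where
  "ray_transform S a F \<xi> =
     integral {0..travel_time S \<xi>}
       (\<lambda>t. weight S a (geodesic_flow S t \<xi>) * F (geodesic_flow S t \<xi>))"

definition s_injective :: "'a surface \<Rightarrow> ('a \<Rightarrow> complex) \<Rightarrow> nat \<Rightarrow> bool" where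
  "s_injective S a k \<longleftrightarrow>
     (\<forall>F. degree_on_fibers S (int k) F \<and> (\<forall>\<xi>\<in>influx_bundle S. ray_transform S a F \<xi> = 0) \<longrightarrow>
        (\<exists>p. degree_on_fibers S (int k - 1) p \<and>
             (\<forall>\<xi>\<in>boundary_bundle S. p \<xi> = 0) \<and>
             (\<forall>\<xi>\<in>unit_bundle S. F \<xi> = geodesic_generator S p \<xi> + a (fst \<xi>) * p \<xi>)))"

definition moment_transform ::
  "'a surface \<Rightarrow> ('a \<Rightarrow> complex) \<Rightarrow> nat \<Rightarrow> nat \<Rightarrow> ('a \<Rightarrow> 'a tvec list \<Rightarrow> complex)
     \<Rightarrow> 'a \<times> 'a tvec \<Rightarrow> complex" where
  "moment_transform S a k m f =
     ray_transform S a (\<lambda>\<xi>. complex_of_real (travel_time S \<xi>) ^ k * ell m f \<xi>)"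

end

theory Submission
  imports Defs
begin

text \<open>By linearity it suffices to show that a symmetric \<open>m\<close>-tensor \<open>h\<close> all of whose moments
  \<open>I\<^sub>a[\<tau>\<^sup>k \<ell>\<^sub>m h]\<close>, \<open>k \<le> m\<close>, vanish is zero.  The restriction \<open>\<ell>\<^sub>m h\<close> to the unit bundle
  is a function of degree \<open>m\<close>, and the proof descends in the degree: if \<open>F\<close> has degree \<open>k\<close> and its
  moments of order \<open>0, \<dots>, k\<close> vanish, then \<open>F = 0\<close> (\<open>vanishing_moments\<close>).  The moment of order \<open>0\<close>
  and s-injectivity give \<open>F = (X + a) p\<close> with \<open>p\<close> of degree \<open>k - 1\<close> and \<open>p = 0\<close> over the boundary.
  Along a geodesic \<open>\<tau>\<close> decreases with unit speed and the weight solves \<open>w' = a w\<close>, so that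
  \<open>w (X + a) p\<close> is the derivative of \<open>w p\<close>; integrating by parts, without boundary terms,
  \<open>I\<^sub>a[\<tau>\<^sup>j\<^sup>+\<^sup>1 F] = - (j + 1) \<integral> \<tau>\<^sup>j \<tau>' w p = (j + 1) I\<^sub>a[\<tau>\<^sup>j p]\<close>
  (\<open>moment_integration_by_parts\<close>).  Hence \<open>p\<close> has degree \<open>k - 1\<close> and \<open>k\<close> vanishing moments.  By
  induction \<open>p = 0\<close>, a function of degree \<open>-1\<close> being zero at the bottom, and then \<open>F = (X + a) p = 0\<close>.
  Finally \<open>h\<close> vanishes on all diagonals \<open>(v, \<dots>, v)\<close> and is zero by polarization.

  This argument needs the geodesic flow to behave as expected.  Geodesics are unique because in a
  chart they solve an ordinary differential equation with locally Lipschitz right-hand side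
  (\<open>geodesic_unique\<close>), so \<open>geodesic_flow\<close> follows any given geodesic.  They keep unit speed
  (\<open>geodesic_unit_speed\<close>), so they stay in the domain where \<open>F = (X + a) p\<close> holds.  The boundary is
  closed and does not depend on the charts (\<open>closedin_boundary\<close>), so the first hitting time is
  attained, and \<open>\<tau>\<close> is affine along the geodesic (\<open>travel_time_along_maximal\<close>).\<close>

section \<open>Functions with smooth local extensions\<close>

lemma Ck_on_imp_continuous_on: "Ck_on n U h \<Longrightarrow> continuous_on U h"
  by (cases n) (auto intro: differentiable_imp_continuous_on)

text \<open>On an open set the derivatives are determined by the values, hence so is the class \<open>C\<^sup>k\<close>.\<close>

lemma Ck_on_cong:
  assumes "open U" "\<And>x. x \<in> U \<Longrightarrow> f x = g x" "Ck_on n U f"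
  shows "Ck_on n U g"
  using assms(2,3)
proof (induction n arbitrary: f g)
  case 0
  then show ?case
    using continuous_on_cong[of U U f g] by simp
next
  case (Suc n)
  have der: "(f has_derivative D) (at x) \<longleftrightarrow> (g has_derivative D) (at x)" if "x \<in> U" for x D
    using has_derivative_transform_within_open[OF _ assms(1) that] Suc.prems(1) by metis
  then have deq: "frechet_derivative f (at x) = frechet_derivative g (at x)" if "x \<in> U" for x
    using that by (simp add: frechet_derivative_def)
  have "g differentiable_on U"
    using Suc.prems der
    by (auto simp: differentiable_on_eq_differentiable_at[OF assms(1)] differentiable_def)
  moreover have "Ck_on n U (\<lambda>x. frechet_derivative g (at x) v)" for v
    by (rule Suc.IH[of "\<lambda>x. frechet_derivative f (at x) v"]) (use Suc.prems deq in auto)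
  ultimately show ?case by simp
qed

lemma Ck_on_subset:
  assumes "open V" "V \<subseteq> U" "Ck_on n U f"
  shows "Ck_on n V f"
  using assms(3)
proof (induction n arbitrary: f)
  case 0 then show ?case using assms continuous_on_subset by auto
next
  case (Suc n)
  then show ?case using assms(2) differentiable_on_subset by auto
qed

lemma Ck_on_SucD: "Ck_on (Suc n) U f \<Longrightarrow> Ck_on n U f"
proof (induction n arbitrary: f)
  case 0 then show ?case using differentiable_imp_continuous_on by auto
next
  case (Suc n)
  show ?case
    using Suc.prems Suc.IH by (subst Ck_on.simps(2), subst (asm) Ck_on.simps(2)) blast
qed

text \<open>Any explicit derivative must agree with the chosen one at interior points; this lets
  the closure properties below be proved with derivative rules.\<close>

lemma Ck_on_SucI:
  assumes "open U" "\<And>x. x \<in> U \<Longrightarrow> (f has_derivative D x) (at x)"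
    "\<And>v. Ck_on n U (\<lambda>x. D x v)"
  shows "Ck_on (Suc n) U f"
proof -
  have "f differentiable_on U"
    using assms(2) by (auto simp: differentiable_on_def differentiable_def intro: has_derivative_at_withinI)
  moreover have "Ck_on n U (\<lambda>x. frechet_derivative f (at x) v)" for v
    by (rule Ck_on_cong[OF assms(1) _ assms(3)]) (simp add: frechet_derivative_at[OF assms(2)])
  ultimately show ?thesis by simp
qed

lemma Ck_on_SucD_deriv:
  assumes "open U" "Ck_on (Suc n) U f" "x \<in> U"
  shows "(f has_derivative frechet_derivative f (at x)) (at x)"
  using assms by (auto simp: differentiable_on_eq_differentiable_at frechet_derivative_works[symmetric])

lemma Ck_on_const: "open U \<Longrightarrow> Ck_on n U (\<lambda>x. c)"
proof (induction n arbitrary: c)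
  case (Suc n)
  show ?case by (rule Ck_on_SucI[where D = "\<lambda>x v. 0"]) (use Suc in auto)
qed simp

lemma Ck_on_add:
  assumes "open U" "Ck_on n U f" "Ck_on n U g"
  shows "Ck_on n U (\<lambda>x. f x + g x)"
  using assms(2,3)
proof (induction n arbitrary: f g)
  case 0 then show ?case by (auto intro: continuous_intros)
next
  case (Suc n)
  show ?case
    by (rule Ck_on_SucI[OF assms(1) has_derivative_add[OF Ck_on_SucD_deriv Ck_on_SucD_deriv]])
      (use Suc assms(1) in auto)
qed

lemma Ck_on_bounded_linear:
  assumes "open U" "bounded_linear L" "Ck_on n U f"
  shows "Ck_on n U (\<lambda>x. L (f x))"
  using assms(3)
proof (induction n arbitrary: f)
  case 0 then show ?case
    using assms(2) by (simp add: bounded_linear.continuous_on)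
next
  case (Suc n)
  show ?case
    by (rule Ck_on_SucI[OF assms(1) bounded_linear.has_derivative[OF assms(2) Ck_on_SucD_deriv]])
      (use Suc assms(1) in auto)
qed

text \<open>The Leibniz rule expresses the derivative by bilinear terms of the same kind, so one induction
  covers real and complex products as well as multiplication by scalars.\<close>

lemma Ck_on_bilinear:
  assumes "open U" "bounded_bilinear P" "Ck_on n U f" "Ck_on n U g"
  shows "Ck_on n U (\<lambda>x. P (f x) (g x))"
  using assms(3,4)
proof (induction n arbitrary: f g)
  case 0 then show ?case
    using assms(2) by (simp add: bounded_bilinear.continuous_on)
next
  case (Suc n)
  have fg: "Ck_on n U f" "Ck_on n U g" using Suc.prems Ck_on_SucD by blast+
  show ?case
    by (rule Ck_on_SucI[OF assms(1) bounded_bilinear.FDERIV[OF assms(2) Ck_on_SucD_deriv Ck_on_SucD_deriv]])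
      (use Suc assms(1) fg in \<open>auto intro!: Ck_on_add\<close>)
qed

lemma Ck_on_inverse:
  fixes f :: "'e::euclidean_space \<Rightarrow> real"
  assumes "open U" "Ck_on n U f" "\<And>x. x \<in> U \<Longrightarrow> f x \<noteq> 0"
  shows "Ck_on n U (\<lambda>x. inverse (f x))"
  using assms(2,3)
proof (induction n)
  case 0 then show ?case by (auto intro: continuous_intros)
next
  case (Suc n)
  have i: "Ck_on n U (\<lambda>x. inverse (f x))" using Suc Ck_on_SucD by blast
  show ?case
  proof (rule Ck_on_SucI[OF assms(1)])
    fix x assume x: "x \<in> U"
    then show "((\<lambda>x. inverse (f x)) has_derivative
        (\<lambda>v. - (inverse (f x) * frechet_derivative f (at x) v * inverse (f x)))) (at x)"
      using Deriv.has_derivative_inverse[OF Suc.prems(2)[OF x] Ck_on_SucD_deriv[OF assms(1) Suc.prems(1) x]] by simp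
  next
    fix v
    show "Ck_on n U (\<lambda>x. - (inverse (f x) * frechet_derivative f (at x) v * inverse (f x)))"
      by (intro Ck_on_bounded_linear[OF assms(1) bounded_linear_minus[OF bounded_linear_ident]]
         Ck_on_bilinear[OF assms(1) bounded_bilinear_mult] i) (use Suc in auto)
  qed
qed

lemma Ck_on_fst:
  fixes f :: "'e::euclidean_space \<Rightarrow> 'f::real_normed_vector"
  assumes "open U" "Ck_on n U f"
  shows "Ck_on n (U \<times> (UNIV :: 'g::euclidean_space set)) (\<lambda>z. f (fst z))"
  using assms(2)
proof (induction n arbitrary: f)
  case 0 then show ?case by (auto intro!: continuous_on_compose2[of U f] continuous_intros)
next
  case (Suc n)
  have op: "open (U \<times> (UNIV :: 'g set))" using assms(1) by (simp add: open_Times)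
  show ?case
  proof (rule Ck_on_SucI[OF op])
    fix z :: "'e \<times> 'g" assume "z \<in> U \<times> UNIV"
    then show "((\<lambda>z. f (fst z)) has_derivative
        (\<lambda>v. frechet_derivative f (at (fst z)) (fst v))) (at z)"
      by (intro has_derivative_compose[OF has_derivative_fst[OF has_derivative_ident]]
          Ck_on_SucD_deriv[OF assms(1) Suc.prems]) auto
  next
    fix v :: "'e \<times> 'g"
    show "Ck_on n (U \<times> (UNIV :: 'g set)) (\<lambda>z. frechet_derivative f (at (fst z)) (fst v))"
      using Suc by auto
  qed
qed

lemma Ck_on_linear:
  assumes "open U" "bounded_linear L"
  shows "Ck_on n U L"
proof (cases n)
  case 0 then show ?thesis using assms linear_continuous_on by auto
next
  case (Suc m)
  show ?thesis unfolding Suc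
    by (rule Ck_on_SucI[OF assms(1) bounded_linear_imp_has_derivative[OF assms(2)]])
      (rule Ck_on_const[OF assms(1)])
qed

lemma smooth_onE:
  assumes "smooth_on D h" "x \<in> D"
  obtains U k where "open U" "x \<in> U" "\<And>n. Ck_on n U k" "\<And>y. y \<in> D \<Longrightarrow> y \<in> U \<Longrightarrow> k y = h y"
  using assms unfolding smooth_on_def by (metis IntI)

lemma smooth_onI:
  assumes "\<And>x. x \<in> D \<Longrightarrow> \<exists>U k. open U \<and> x \<in> U \<and> (\<forall>n. Ck_on n U k) \<and> (\<forall>y\<in>D \<inter> U. k y = h y)"
  shows "smooth_on D h"
  using assms unfolding smooth_on_def by blast

lemma smooth_on_cong:
  assumes "smooth_on D f" "\<And>x. x \<in> D \<Longrightarrow> f x = g x"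
  shows "smooth_on D g"
  using assms by (auto simp: smooth_on_def)

lemma smooth_on_subset:
  assumes "smooth_on D f" "E \<subseteq> D"
  shows "smooth_on E f"
proof (rule smooth_onI)
  fix x assume "x \<in> E"
  then have "x \<in> D" using assms(2) by blast
  from smooth_onE[OF assms(1) this] obtain U k
    where "open U" "x \<in> U" "\<And>n. Ck_on n U k" "\<And>y. y \<in> D \<Longrightarrow> y \<in> U \<Longrightarrow> k y = f y" by metis
  then show "\<exists>U k. open U \<and> x \<in> U \<and> (\<forall>n. Ck_on n U k) \<and> (\<forall>y\<in>E \<inter> U. k y = f y)"
    using assms(2) by blast
qed

lemma smooth_on_linear: "bounded_linear L \<Longrightarrow> smooth_on D L"
  by (rule smooth_onI, rule exI[of _ UNIV]) (auto intro: Ck_on_linear)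

lemma smooth_on_const: "smooth_on D (\<lambda>x. c)"
  by (rule smooth_onI, rule exI[of _ UNIV]) (auto intro: Ck_on_const)

lemma smooth_on_bounded_linear:
  assumes "bounded_linear L" "smooth_on D f"
  shows "smooth_on D (\<lambda>x. L (f x))"
proof (rule smooth_onI)
  fix x assume "x \<in> D"
  from smooth_onE[OF assms(2) this] obtain U k
    where "open U" "x \<in> U" "\<And>n. Ck_on n U k" "\<And>y. y \<in> D \<Longrightarrow> y \<in> U \<Longrightarrow> k y = f y" by metis
  then show "\<exists>U k. open U \<and> x \<in> U \<and> (\<forall>n. Ck_on n U k) \<and> (\<forall>y\<in>D \<inter> U. k y = L (f y))"
    using assms(1) by (intro exI[of _ U] exI[of _ "\<lambda>x. L (k x)"]) (auto intro: Ck_on_bounded_linear)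
qed

lemma smooth_on_add:
  assumes "smooth_on D f" "smooth_on D g"
  shows "smooth_on D (\<lambda>x. f x + g x)"
proof (rule smooth_onI)
  fix x assume x: "x \<in> D"
  from smooth_onE[OF assms(1) x] obtain U k
    where 1: "open U" "x \<in> U" "\<And>n. Ck_on n U k" "\<And>y. y \<in> D \<Longrightarrow> y \<in> U \<Longrightarrow> k y = f y" by metis
  from smooth_onE[OF assms(2) x] obtain V l
    where 2: "open V" "x \<in> V" "\<And>n. Ck_on n V l" "\<And>y. y \<in> D \<Longrightarrow> y \<in> V \<Longrightarrow> l y = g y" by metis
  show "\<exists>U k. open U \<and> x \<in> U \<and> (\<forall>n. Ck_on n U k) \<and> (\<forall>y\<in>D \<inter> U. k y = f y + g y)"
    using 1 2 by (intro exI[of _ "U \<inter> V"] exI[of _ "\<lambda>x. k x + l x"])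
      (auto intro!: Ck_on_add intro: Ck_on_subset)
qed

lemma smooth_on_bilinear:
  assumes "bounded_bilinear P" "smooth_on D f" "smooth_on D g"
  shows "smooth_on D (\<lambda>x. P (f x) (g x))"
proof (rule smooth_onI)
  fix x assume x: "x \<in> D"
  from smooth_onE[OF assms(2) x] obtain U k
    where 1: "open U" "x \<in> U" "\<And>n. Ck_on n U k" "\<And>y. y \<in> D \<Longrightarrow> y \<in> U \<Longrightarrow> k y = f y" by metis
  from smooth_onE[OF assms(3) x] obtain V l
    where 2: "open V" "x \<in> V" "\<And>n. Ck_on n V l" "\<And>y. y \<in> D \<Longrightarrow> y \<in> V \<Longrightarrow> l y = g y" by metis
  show "\<exists>U k. open U \<and> x \<in> U \<and> (\<forall>n. Ck_on n U k) \<and> (\<forall>y\<in>D \<inter> U. k y = P (f y) (g y))"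
    using 1 2 by (intro exI[of _ "U \<inter> V"] exI[of _ "\<lambda>x. P (k x) (l x)"])
      (auto intro!: Ck_on_bilinear[OF _ assms(1)] intro: Ck_on_subset)
qed

lemmas smooth_on_mult = smooth_on_bilinear[OF bounded_bilinear_mult]
lemmas smooth_on_scaleR = smooth_on_bilinear[OF bounded_bilinear_scaleR]
lemmas smooth_on_uminus = smooth_on_bounded_linear[OF bounded_linear_minus[OF bounded_linear_ident]]

lemma smooth_on_diff: "smooth_on D f \<Longrightarrow> smooth_on D g \<Longrightarrow> smooth_on D (\<lambda>x. f x - g x)"
  using smooth_on_add[of D f "\<lambda>x. - g x"] smooth_on_uminus[of D g] by simp

lemma smooth_on_sum:
  "finite I \<Longrightarrow> (\<And>i. i \<in> I \<Longrightarrow> smooth_on D (f i)) \<Longrightarrow> smooth_on D (\<lambda>x. \<Sum>i\<in>I. f i x)"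
  by (induction I rule: finite_induct) (auto intro: smooth_on_const smooth_on_add)

lemma smooth_on_power:
  fixes f :: "'e::euclidean_space \<Rightarrow> 'f::real_normed_algebra_1"
  shows "smooth_on D f \<Longrightarrow> smooth_on D (\<lambda>x. f x ^ n)"
  by (induction n) (auto intro: smooth_on_const smooth_on_mult)

lemma smooth_on_inverse:
  fixes f :: "'e::euclidean_space \<Rightarrow> real"
  assumes "smooth_on D f" "\<And>x. x \<in> D \<Longrightarrow> f x \<noteq> 0"
  shows "smooth_on D (\<lambda>x. inverse (f x))"
proof (rule smooth_onI)
  fix x assume x: "x \<in> D"
  from smooth_onE[OF assms(1) x] obtain U k
    where 1: "open U" "x \<in> U" "\<And>n. Ck_on n U k" "\<And>y. y \<in> D \<Longrightarrow> y \<in> U \<Longrightarrow> k y = f y" by metis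
  define V where "V = {y \<in> U. k y \<noteq> 0}"
  have "continuous_on U k" using 1(3) Ck_on_imp_continuous_on by blast
  then have "open V"
    unfolding V_def using continuous_open_preimage[OF _ 1(1), of k "- {0}"]
    by (simp add: vimage_def Int_def open_Compl)
  moreover have "Ck_on n V (\<lambda>y. inverse (k y))" for n
    by (rule Ck_on_inverse) (use \<open>open V\<close> 1(3) Ck_on_subset[OF \<open>open V\<close>, of U] V_def in auto)
  moreover have "x \<in> V" using 1 x assms(2) by (auto simp: V_def)
  ultimately show "\<exists>U k. open U \<and> x \<in> U \<and> (\<forall>n. Ck_on n U k) \<and> (\<forall>y\<in>D \<inter> U. k y = inverse (f y))"
    using 1 by (intro exI[of _ V] exI[of _ "\<lambda>y. inverse (k y)"]) (auto simp: V_def)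
qed

lemma smooth_on_fst:
  fixes f :: "'e::euclidean_space \<Rightarrow> 'f::real_normed_vector"
  assumes "smooth_on D f"
  shows "smooth_on (D \<times> (UNIV :: 'g::euclidean_space set)) (\<lambda>z. f (fst z))"
proof (rule smooth_onI)
  fix z :: "'e \<times> 'g" assume "z \<in> D \<times> UNIV"
  then have "fst z \<in> D" by auto
  from smooth_onE[OF assms this] obtain U k
    where "open U" "fst z \<in> U" "\<And>n. Ck_on n U k" "\<And>y. y \<in> D \<Longrightarrow> y \<in> U \<Longrightarrow> k y = f y" by metis
  then show "\<exists>U k. open U \<and> z \<in> U \<and> (\<forall>n. Ck_on n U k) \<and> (\<forall>y\<in>(D \<times> UNIV) \<inter> U. k y = f (fst y))"
    by (intro exI[of _ "U \<times> UNIV"] exI[of _ "\<lambda>z. k (fst z)"])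
      (auto simp: open_Times mem_Times_iff intro: Ck_on_fst)
qed

lemma smooth_on_imp_differentiable:
  assumes "smooth_on D f" "x \<in> D"
  shows "f differentiable (at x within D)"
proof -
  from smooth_onE[OF assms] obtain U k
    where 1: "open U" "x \<in> U" "\<And>n. Ck_on n U k" "\<And>y. y \<in> D \<Longrightarrow> y \<in> U \<Longrightarrow> k y = f y" by metis
  have "(k has_derivative frechet_derivative k (at x)) (at x within D)"
    using Ck_on_SucD_deriv[OF 1(1) 1(3) 1(2)] has_derivative_at_withinI by blast
  moreover have "\<forall>\<^sub>F y in at x within D. k y = f y"
    unfolding eventually_at_topological using 1 by blast
  ultimately have "(f has_derivative frechet_derivative k (at x)) (at x within D)"
    using has_derivative_transform_eventually 1(2,4) assms(2) by metis
  then show ?thesis unfolding differentiable_def by blast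
qed

lemma smooth_on_imp_continuous_on: "smooth_on D f \<Longrightarrow> continuous_on D f"
  using smooth_on_imp_differentiable differentiable_imp_continuous_on differentiable_on_def by blast

text \<open>The domain need not be convex, so the mean value inequality is applied to a smooth extension on a
  closed ball, where the continuous derivative is bounded by compactness.\<close>

lemma smooth_on_locally_Lipschitz:
  fixes f :: "'e::euclidean_space \<Rightarrow> 'f::real_normed_vector"
  assumes "smooth_on D f" "x \<in> D"
  obtains e L where "e > 0" "L \<ge> 0"
    "\<And>y z. y \<in> D \<inter> ball x e \<Longrightarrow> z \<in> D \<inter> ball x e \<Longrightarrow> norm (f y - f z) \<le> L * norm (y - z)"
proof -
  from smooth_onE[OF assms] obtain U k
    where 1: "open U" "x \<in> U" "\<And>n. Ck_on n U k" "\<And>y. y \<in> D \<Longrightarrow> y \<in> U \<Longrightarrow> k y = f y" by metis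
  obtain e where e: "e > 0" "cball x e \<subseteq> U"
    using 1 open_contains_cball by blast
  have C1: "Ck_on (Suc 0) U k" using 1 by blast
  have "\<exists>B. \<forall>y\<in>cball x e. norm (frechet_derivative k (at y) b) \<le> B" for b
  proof -
    have "continuous_on (cball x e) (\<lambda>y. frechet_derivative k (at y) b)"
      by (rule continuous_on_subset[OF _ e(2)]) (use C1 in auto)
    then have "bounded ((\<lambda>y. frechet_derivative k (at y) b) ` cball x e)"
      using compact_continuous_image compact_imp_bounded compact_cball by blast
    then show ?thesis unfolding bounded_iff by auto
  qed
  then obtain B where B: "\<And>b y. y \<in> cball x e \<Longrightarrow> norm (frechet_derivative k (at y) b) \<le> B b"
    by metis
  define L where "L = (\<Sum>b\<in>Basis. \<bar>B b\<bar>)"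
  have der: "(k has_derivative frechet_derivative k (at y)) (at y)" if "y \<in> cball x e" for y
    using Ck_on_SucD_deriv[OF 1(1) C1] e(2) that by blast
  have on: "onorm (frechet_derivative k (at y)) \<le> L" if y: "y \<in> cball x e" for y
  proof (rule onorm_le)
    fix v
    have lin: "linear (frechet_derivative k (at y))"
      using der[OF y] has_derivative_linear by blast
    have "frechet_derivative k (at y) v
        = frechet_derivative k (at y) (\<Sum>b\<in>Basis. (v \<bullet> b) *\<^sub>R b)"
      by (simp add: euclidean_representation)
    also have "\<dots> = (\<Sum>b\<in>Basis. (v \<bullet> b) *\<^sub>R frechet_derivative k (at y) b)"
      using lin by (simp add: linear_sum linear_scale)
    also have "norm \<dots> \<le> (\<Sum>b\<in>Basis. norm v * \<bar>B b\<bar>)"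
      by (rule sum_norm_le) (use order_trans[OF B[OF y] abs_ge_self] Basis_le_norm in \<open>auto intro!: mult_mono\<close>)
    finally show "norm (frechet_derivative k (at y) v) \<le> L * norm v"
      by (simp add: L_def sum_distrib_left mult.commute)
  qed
  show thesis
  proof
    show "e > 0" "L \<ge> 0" using e by (auto simp: L_def sum_nonneg)
    fix y z assume yz: "y \<in> D \<inter> ball x e" "z \<in> D \<inter> ball x e"
    have "norm (k y - k z) \<le> L * norm (y - z)"
      by (rule differentiable_bound[OF convex_cball has_derivative_at_withinI[OF der] on])
        (use yz in auto)
    moreover have "ball x e \<subseteq> U" using e(2) ball_subset_cball by blast
    then have "k y = f y" "k z = f z" using yz 1(4) by blast+
    ultimately show "norm (f y - f z) \<le> L * norm (y - z)" by simp
  qed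
qed

section \<open>Relatively open subsets of the half plane\<close>

lemma openin_half_plane_at_within:
  assumes "openin (top_of_set half_plane) A" "y \<in> A"
  shows "at y within A = at y within half_plane"
proof -
  obtain T where T: "open T" "A = half_plane \<inter> T" using assms(1) openin_open by blast
  show ?thesis by (rule at_within_nhd[OF _ T(1)]) (use T assms in auto)
qed

text \<open>From every point of such a set one can move a little along each coordinate axis, at least to one
  side.  This makes one-sided derivatives at boundary points unique.\<close>

lemma openin_half_plane_directions:
  assumes "openin (top_of_set half_plane) A" "y \<in> A" "i \<in> Basis" "e > 0"
  shows "\<exists>d. 0 < \<bar>d\<bar> \<and> \<bar>d\<bar> < e \<and> y + d *\<^sub>R i \<in> A"
proof -
  obtain T where T: "open T" "A = half_plane \<inter> T" using assms(1) openin_open by blast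
  then obtain r where r: "r > 0" "ball y r \<subseteq> T" using assms(2) openE by blast
  define d where "d = min e r / 2"
  have d: "0 < d" "d < e" "d < r" using assms(4) r by (auto simp: d_def min_def)
  have "0 \<le> i $ 2" using assms(3) by (auto simp: Basis_vec_def axis_def)
  then have "y + d *\<^sub>R i \<in> half_plane"
    using assms(2) T d by (simp add: half_plane_def)
  moreover have "y + d *\<^sub>R i \<in> ball y r"
    using d assms(3) by (simp add: dist_norm)
  ultimately show ?thesis using d r(2) T(2) by (intro exI[of _ d]) auto
qed

lemma has_derivative_unique_half_plane:
  assumes "openin (top_of_set half_plane) A" "y \<in> A"
    "(f has_derivative D) (at y within A)" "(f has_derivative E) (at y within A)"
  shows "D = E"
  using frechet_derivative_unique_within[OF assms(3,4)] openin_half_plane_directions[OF assms(1,2)]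
  by blast

lemma frechet_derivative_half_plane:
  assumes "openin (top_of_set half_plane) A" "y \<in> A" "(f has_derivative D) (at y within A)"
  shows "frechet_derivative f (at y within A) = D"
proof -
  have "(f has_derivative frechet_derivative f (at y within A)) (at y within A)"
    using assms(3) frechet_derivative_works differentiableI by blast
  then show ?thesis using has_derivative_unique_half_plane assms by blast
qed

lemma frechet_derivative_half_plane_Times:
  fixes \<eta> :: "real^2"
  assumes "openin (top_of_set half_plane) A" "y \<in> A" "\<eta> \<noteq> 0"
    "(f has_derivative D) (at (y, \<eta>) within A \<times> (- {0}))"
  shows "frechet_derivative f (at (y, \<eta>) within A \<times> (- {0})) = D"
proof (rule frechet_derivative_unique_within[OF _ assms(4)])
  show "(f has_derivative frechet_derivative f (at (y, \<eta>) within A \<times> (- {0}))) (at (y, \<eta>) within A \<times> (- {0}))"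
    using assms(4) frechet_derivative_works differentiableI by blast
next
  fix i :: "(real^2) \<times> (real^2)" and e :: real
  assume i: "i \<in> Basis" and e: "e > 0"
  show "\<exists>d. 0 < \<bar>d\<bar> \<and> \<bar>d\<bar> < e \<and> (y, \<eta>) + d *\<^sub>R i \<in> A \<times> (- {0})"
  proof (cases "snd i = 0")
    case True
    then have "fst i \<in> Basis" using i by (auto simp: Basis_prod_def)
    from openin_half_plane_directions[OF assms(1,2) this e] show ?thesis
      using True assms(3) by (cases i) auto
  next
    case False
    then have i2: "snd i \<in> Basis" "fst i = 0" using i by (auto simp: Basis_prod_def)
    define d where "d = min e (norm \<eta>) / 2"
    have d: "0 < d" "d < e" "d < norm \<eta>" using e assms(3) by (auto simp: d_def min_def)
    have "\<eta> + d *\<^sub>R snd i \<noteq> 0"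
    proof
      assume "\<eta> + d *\<^sub>R snd i = 0"
      then have "\<eta> = - (d *\<^sub>R snd i)" by (simp add: eq_neg_iff_add_eq_0)
      then have "norm \<eta> = d" using d i2 by simp
      then show False using d by simp
    qed
    then show ?thesis using d i2 assms(2) by (intro exI[of _ d]) (cases i, auto)
  qed
qed

text \<open>The derivative within the set is the derivative of any smooth local extension, by uniqueness.\<close>

lemma smooth_on_frechet_derivative:
  assumes "smooth_on A f" "openin (top_of_set half_plane) A"
  shows "smooth_on A (\<lambda>y. frechet_derivative f (at y within A) v)"
proof (rule smooth_onI)
  fix x assume "x \<in> A"
  from smooth_onE[OF assms(1) this] obtain U k
    where 1: "open U" "x \<in> U" "\<And>n. Ck_on n U k" "\<And>y. y \<in> A \<Longrightarrow> y \<in> U \<Longrightarrow> k y = f y" by metis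
  have "frechet_derivative k (at y) v = frechet_derivative f (at y within A) v" if y: "y \<in> A \<inter> U" for y
  proof -
    have "(k has_derivative frechet_derivative k (at y)) (at y within A)"
      using Ck_on_SucD_deriv[OF 1(1) 1(3)] y has_derivative_at_withinI by blast
    moreover have "\<forall>\<^sub>F z in at y within A. k z = f z"
      unfolding eventually_at_topological using 1 y by blast
    ultimately have "(f has_derivative frechet_derivative k (at y)) (at y within A)"
      using has_derivative_transform_eventually 1(4) y by (metis IntD1 IntD2)
    then show ?thesis using frechet_derivative_half_plane[OF assms(2)] y by (metis IntD1)
  qed
  moreover have "Ck_on n U (\<lambda>y. frechet_derivative k (at y) v)" for n
    using 1(3)[of "Suc n"] by simp
  ultimately show "\<exists>U k. open U \<and> x \<in> U \<and> (\<forall>n. Ck_on n U k) \<and>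
      (\<forall>y\<in>A \<inter> U. k y = frechet_derivative f (at y within A) v)"
    using 1 by blast
qed

section \<open>Charts, tangent vectors and the metric\<close>

locale riemannian_surface =
  fixes S :: "'a surface"
  assumes smooth: "smooth_surface S" and metric: "riemannian_metric S"
begin

lemma charts_at_atlas: "c \<in> charts_at S x \<Longrightarrow> c \<in> atlas S" "c \<in> charts_at S x \<Longrightarrow> x \<in> fst c"
  by (auto simp: charts_at_def)

lemma chart_open: "c \<in> atlas S \<Longrightarrow> openin (space_of S) (fst c)"
  using smooth by (auto simp: smooth_surface_def)

lemma chart_subset: "c \<in> atlas S \<Longrightarrow> fst c \<subseteq> points S"
  using chart_open openin_subset by blast

lemma cdom_openin: "c \<in> atlas S \<Longrightarrow> openin (top_of_set half_plane) (cdom c)"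
  using smooth by (auto simp: smooth_surface_def)

lemma chart_homeo:
  "c \<in> atlas S \<Longrightarrow> homeomorphic_map (subtopology (space_of S) (fst c)) (top_of_set (cdom c)) (snd c)"
  using smooth by (auto simp: smooth_surface_def)

lemma charts_at_nonempty: "x \<in> points S \<Longrightarrow> \<exists>c. c \<in> charts_at S x"
proof -
  assume "x \<in> points S"
  then have "x \<in> (\<Union>c\<in>atlas S. fst c)" using smooth unfolding smooth_surface_def by metis
  then show ?thesis by (auto simp: charts_at_def)
qed

lemma chart_at_charts_at: "x \<in> points S \<Longrightarrow> chart_at S x \<in> charts_at S x"
  unfolding chart_at_def using charts_at_nonempty someI_ex[of "\<lambda>c. c \<in> charts_at S x"] by blast

lemma chart_inj: "c \<in> atlas S \<Longrightarrow> inj_on (snd c) (fst c)"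
  using homeomorphic_imp_injective_map[OF chart_homeo] chart_subset
  by (simp add: Int_absorb1)

lemma cpoint_chart: "c \<in> atlas S \<Longrightarrow> x \<in> fst c \<Longrightarrow> cpoint c (snd c x) = x"
  by (simp add: cpoint_def chart_inj)

lemma cpoint_in: "y \<in> cdom c \<Longrightarrow> cpoint c y \<in> fst c"
  by (simp add: cpoint_def cdom_def inv_into_into)

lemma chart_cpoint: "y \<in> cdom c \<Longrightarrow> snd c (cpoint c y) = y"
  by (simp add: cpoint_def cdom_def f_inv_into_f)

lemma chart_in_cdom: "x \<in> fst c \<Longrightarrow> snd c x \<in> cdom c"
  by (simp add: cdom_def)

lemma cpoint_charts_at: "c \<in> atlas S \<Longrightarrow> y \<in> cdom c \<Longrightarrow> c \<in> charts_at S (cpoint c y)"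
  by (simp add: charts_at_def cpoint_in)

lemma cpoint_points: "c \<in> atlas S \<Longrightarrow> y \<in> cdom c \<Longrightarrow> cpoint c y \<in> points S"
  using cpoint_in chart_subset by blast

lemma cdom_half_plane: "c \<in> atlas S \<Longrightarrow> cdom c \<subseteq> half_plane"
  using cdom_openin openin_imp_subset by blast

lemma chart_in_half_plane: "c \<in> atlas S \<Longrightarrow> x \<in> fst c \<Longrightarrow> snd c x \<in> half_plane"
  by (rule subsetD[OF cdom_half_plane chart_in_cdom])

lemma chart_image_openin:
  assumes "c \<in> atlas S" "openin (space_of S) W" "W \<subseteq> fst c"
  shows "openin (top_of_set half_plane) (snd c ` W)"
proof -
  have "openin (subtopology (space_of S) (fst c)) W"
    using assms by (metis openin_subtopology_Int2 inf.absorb_iff2)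
  then have "openin (top_of_set (cdom c)) (snd c ` W)"
    using homeomorphic_imp_open_map[OF chart_homeo[OF assms(1)]] by (simp add: open_map_def)
  then show ?thesis using cdom_openin[OF assms(1)] openin_trans by blast
qed

lemma overlap_openin:
  assumes "c \<in> atlas S" "d \<in> atlas S"
  shows "openin (top_of_set half_plane) (snd c ` (fst c \<inter> fst d))"
  using chart_image_openin[OF assms(1)] chart_open assms by blast

lemma transition_has_derivative:
  assumes "c \<in> charts_at S x" "d \<in> charts_at S x"
  shows "((snd d \<circ> cpoint c) has_derivative transition_deriv c d x) (at (snd c x) within half_plane)"
proof -
  have x: "snd c x \<in> snd c ` (fst c \<inter> fst d)" using assms by (auto simp: charts_at_def)
  have at: "c \<in> atlas S" "d \<in> atlas S" using assms by (auto simp: charts_at_def)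
  have "smooth_on (snd c ` (fst c \<inter> fst d)) (snd d \<circ> cpoint c)"
    using smooth at by (auto simp: smooth_surface_def)
  from smooth_on_imp_differentiable[OF this x] show ?thesis
    by (simp add: transition_deriv_def frechet_derivative_works
        openin_half_plane_at_within[OF overlap_openin[OF at] x])
qed

lemma transition_linear:
  "c \<in> charts_at S x \<Longrightarrow> d \<in> charts_at S x \<Longrightarrow> linear (transition_deriv c d x)"
  using transition_has_derivative has_derivative_linear by blast

text \<open>The chain rule on the triple overlap; all derivatives are taken within the half plane, where they
  are unique.  It makes the family \<open>tvec_of\<close> a tangent vector.\<close>

lemma transition_cocycle:
  assumes "b \<in> charts_at S x" "c \<in> charts_at S x" "d \<in> charts_at S x"
  shows "transition_deriv c d x (transition_deriv b c x \<eta>) = transition_deriv b d x \<eta>"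
proof -
  have at: "b \<in> atlas S" "c \<in> atlas S" "d \<in> atlas S" "x \<in> fst b" "x \<in> fst c" "x \<in> fst d"
    using assms by (auto simp: charts_at_def)
  define W where "W = fst b \<inter> fst c \<inter> fst d"
  have W: "openin (top_of_set half_plane) (snd b ` W)"
    by (rule chart_image_openin[OF at(1)]) (auto simp: W_def intro!: openin_Int chart_open at)
  have x: "snd b x \<in> snd b ` W" using at by (auto simp: W_def)
  have sub: "(snd c \<circ> cpoint b) ` (snd b ` W) \<subseteq> half_plane"
    using at by (auto simp: W_def cpoint_chart chart_in_half_plane)
  have 1: "((snd c \<circ> cpoint b) has_derivative transition_deriv b c x) (at (snd b x) within snd b ` W)"
    using transition_has_derivative[OF assms(1,2)] by (simp add: openin_half_plane_at_within[OF W x])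
  have "((snd d \<circ> cpoint c) has_derivative transition_deriv c d x)
      (at ((snd c \<circ> cpoint b) (snd b x)) within (snd c \<circ> cpoint b) ` (snd b ` W))"
    using has_derivative_subset[OF transition_has_derivative[OF assms(2,3)] sub] at
    by (simp add: cpoint_chart)
  from diff_chain_within[OF 1 this]
  have "((snd d \<circ> cpoint c) \<circ> (snd c \<circ> cpoint b) has_derivative
      transition_deriv c d x \<circ> transition_deriv b c x) (at (snd b x) within snd b ` W)" .
  then have "((snd d \<circ> cpoint b) has_derivative
      transition_deriv c d x \<circ> transition_deriv b c x) (at (snd b x) within snd b ` W)"
    by (rule has_derivative_transform[rotated 2]) (use x at in \<open>auto simp: W_def cpoint_chart\<close>)
  moreover have "((snd d \<circ> cpoint b) has_derivative transition_deriv b d x) (at (snd b x) within snd b ` W)"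
    using transition_has_derivative[OF assms(1,3)] by (simp add: openin_half_plane_at_within[OF W x])
  ultimately have "transition_deriv c d x \<circ> transition_deriv b c x = transition_deriv b d x"
    using has_derivative_unique_half_plane[OF W x] by blast
  then show ?thesis by (metis comp_apply)
qed

lemma transition_self:
  assumes "c \<in> charts_at S x"
  shows "transition_deriv c c x \<eta> = \<eta>"
proof -
  have at: "c \<in> atlas S" "x \<in> fst c" using assms by (auto simp: charts_at_def)
  have x: "snd c x \<in> cdom c" by (rule chart_in_cdom[OF at(2)])
  have "((snd c \<circ> cpoint c) has_derivative transition_deriv c c x) (at (snd c x) within cdom c)"
    using transition_has_derivative[OF assms assms]
    by (simp add: openin_half_plane_at_within[OF cdom_openin[OF at(1)] x])
  moreover have "((snd c \<circ> cpoint c) has_derivative (\<lambda>h. h)) (at (snd c x) within cdom c)"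
    by (rule has_derivative_transform[OF x _ has_derivative_ident]) (simp add: chart_cpoint)
  ultimately have "transition_deriv c c x = (\<lambda>h. h)"
    using has_derivative_unique_half_plane[OF cdom_openin[OF at(1)] x] by blast
  then show ?thesis by simp
qed

lemma tvec_of_in:
  assumes "c \<in> charts_at S x"
  shows "tvec_of S c x \<eta> \<in> tangent_space S x"
  using transition_cocycle[OF assms] by (auto simp: tangent_space_def tvec_of_def)

lemma tvec_of_chart: "c \<in> charts_at S x \<Longrightarrow> tvec_of S c x \<eta> c = \<eta>"
  by (simp add: tvec_of_def transition_self)

lemma tvec_of_coords:
  assumes "c \<in> charts_at S x" "v \<in> tangent_space S x"
  shows "tvec_of S c x (v c) = v"
proof
  fix d
  have "d \<in> charts_at S x \<Longrightarrow> v d = transition_deriv c d x (v c)"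
    "d \<notin> charts_at S x \<Longrightarrow> v d = 0"
    using assms unfolding tangent_space_def by blast+
  then show "tvec_of S c x (v c) d = v d" by (simp add: tvec_of_def)
qed

lemma tangent_eqI:
  assumes "c \<in> charts_at S x" "v \<in> tangent_space S x" "w \<in> tangent_space S x" "v c = w c"
  shows "v = w"
  using assms tvec_of_coords by metis

lemma tcomb_in:
  assumes "v \<in> tangent_space S x" "w \<in> tangent_space S x"
  shows "tcomb r v s w \<in> tangent_space S x"
  unfolding tangent_space_def mem_Collect_eq
proof (intro conjI ballI allI impI)
  fix c d assume cd: "c \<in> charts_at S x" "d \<in> charts_at S x"
  have "v d = transition_deriv c d x (v c)" "w d = transition_deriv c d x (w c)"
    using assms cd unfolding tangent_space_def by blast+
  then show "tcomb r v s w d = transition_deriv c d x (tcomb r v s w c)"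
    using transition_linear[OF cd] by (simp add: tcomb_def linear_add linear_scale)
next
  fix c assume "c \<notin> charts_at S x"
  then have "v c = 0" "w c = 0" using assms unfolding tangent_space_def by blast+
  then show "tcomb r v s w c = 0" by (simp add: tcomb_def)
qed

lemma tcomb_chart: "tcomb r v s w c = r *\<^sub>R v c + s *\<^sub>R w c"
  by (simp add: tcomb_def)

lemma coord_field_in:
  assumes "c \<in> atlas S" "y \<in> cdom c"
  shows "coord_field S c i y \<in> tangent_space S (cpoint c y)"
  using assms by (simp add: coord_field_def tvec_of_in cpoint_charts_at)

lemma coord_field_chart:
  assumes "c \<in> atlas S" "y \<in> cdom c"
  shows "coord_field S c i y c = axis i 1"
  using assms by (simp add: coord_field_def tvec_of_chart cpoint_charts_at)

lemma coord_decomp: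
  assumes "c \<in> charts_at S x" "v \<in> tangent_space S x"
  shows "v = tcomb (v c $ 1) (coord_field S c 1 (snd c x)) (v c $ 2) (coord_field S c 2 (snd c x))"
proof (rule tangent_eqI[OF assms])
  have c: "c \<in> atlas S" "snd c x \<in> cdom c" "cpoint c (snd c x) = x"
    using assms by (auto simp: charts_at_def chart_in_cdom cpoint_chart)
  show "tcomb (v c $ 1) (coord_field S c 1 (snd c x)) (v c $ 2) (coord_field S c 2 (snd c x)) \<in> tangent_space S x"
    using tcomb_in coord_field_in[OF c(1,2)] c(3) by simp
  show "v c = tcomb (v c $ 1) (coord_field S c 1 (snd c x)) (v c $ 2) (coord_field S c 2 (snd c x)) c"
    by (simp add: tcomb_chart coord_field_chart[OF c(1,2)] vec_eq_iff forall_2 axis_def)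
qed

lemma metric_sym:
  "x \<in> points S \<Longrightarrow> u \<in> tangent_space S x \<Longrightarrow> v \<in> tangent_space S x \<Longrightarrow> metric S x u v = metric S x v u"
  using metric by (auto simp: riemannian_metric_def)

lemma metric_left:
  "x \<in> points S \<Longrightarrow> u \<in> tangent_space S x \<Longrightarrow> v \<in> tangent_space S x \<Longrightarrow> w \<in> tangent_space S x \<Longrightarrow>
   metric S x (tcomb r u s v) w = r * metric S x u w + s * metric S x v w"
  using metric by (auto simp: riemannian_metric_def)

lemma metric_right:
  "x \<in> points S \<Longrightarrow> u \<in> tangent_space S x \<Longrightarrow> v \<in> tangent_space S x \<Longrightarrow> w \<in> tangent_space S x \<Longrightarrow>
   metric S x w (tcomb r u s v) = r * metric S x w u + s * metric S x w v"
  by (simp add: metric_sym[of x w] metric_left tcomb_in)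

lemma metric_pos:
  "x \<in> points S \<Longrightarrow> v \<in> tangent_space S x \<Longrightarrow> v \<noteq> (\<lambda>_. 0) \<Longrightarrow> 0 < metric S x v v"
  using metric by (auto simp: riemannian_metric_def)

lemma charts_at_points: "c \<in> charts_at S x \<Longrightarrow> x \<in> points S"
  using charts_at_atlas chart_subset by blast

lemma metric_coords:
  assumes "c \<in> charts_at S x" "v \<in> tangent_space S x" "w \<in> tangent_space S x"
  shows "metric S x v w = (\<Sum>i\<in>UNIV. \<Sum>j\<in>UNIV. metric_coeff S c i j (snd c x) * v c $ i * w c $ j)"
proof -
  have c: "c \<in> atlas S" "snd c x \<in> cdom c" "cpoint c (snd c x) = x"
    using assms by (auto simp: charts_at_def chart_in_cdom cpoint_chart)
  have x: "x \<in> points S" using assms charts_at_points by blast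
  have e: "coord_field S c i (snd c x) \<in> tangent_space S x" for i
    using coord_field_in[OF c(1,2)] c(3) by simp
  have "metric S x v w =
    metric S x (tcomb (v c $ 1) (coord_field S c 1 (snd c x)) (v c $ 2) (coord_field S c 2 (snd c x)))
     (tcomb (w c $ 1) (coord_field S c 1 (snd c x)) (w c $ 2) (coord_field S c 2 (snd c x)))"
    by (simp flip: coord_decomp[OF assms(1,2)] coord_decomp[OF assms(1,3)])
  then show ?thesis
    by (simp add: metric_left metric_right x e tcomb_in sum_2 metric_coeff_def c(3) algebra_simps)
qed

definition coord_norm_sq :: "'a chart \<Rightarrow> (real^2) \<times> (real^2) \<Rightarrow> real" where
  "coord_norm_sq c = (\<lambda>(y, \<eta>). \<Sum>i\<in>UNIV. \<Sum>j\<in>UNIV. metric_coeff S c i j y * \<eta> $ i * \<eta> $ j)"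

lemma metric_coord_norm_sq:
  "c \<in> charts_at S x \<Longrightarrow> v \<in> tangent_space S x \<Longrightarrow> metric S x v v = coord_norm_sq c (snd c x, v c)"
  by (simp add: metric_coords coord_norm_sq_def)

lemma tangent_nonzero_iff:
  "c \<in> charts_at S x \<Longrightarrow> v \<in> tangent_space S x \<Longrightarrow> v = (\<lambda>_. 0) \<longleftrightarrow> v c = 0"
proof
  assume a: "c \<in> charts_at S x" "v \<in> tangent_space S x" "v c = 0"
  have "tcomb 0 v 0 v \<in> tangent_space S x" using a tcomb_in by blast
  then have "(\<lambda>_. 0) \<in> tangent_space S x" by (simp add: tcomb_def)
  then show "v = (\<lambda>_. 0)" using a tangent_eqI by metis
qed auto

lemma coord_norm_sq_pos:
  assumes "c \<in> atlas S" "y \<in> cdom c" "\<eta> \<noteq> 0"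
  shows "coord_norm_sq c (y, \<eta>) > 0"
proof -
  have c: "c \<in> charts_at S (cpoint c y)" using assms cpoint_charts_at by blast
  have "metric S (cpoint c y) (tvec_of S c (cpoint c y) \<eta>) (tvec_of S c (cpoint c y) \<eta>) > 0"
    using metric_pos[OF charts_at_points[OF c] tvec_of_in[OF c]] tangent_nonzero_iff[OF c tvec_of_in[OF c]]
      tvec_of_chart[OF c] assms(3) by metis
  then show ?thesis
    by (simp add: metric_coord_norm_sq[OF c tvec_of_in[OF c]] tvec_of_chart[OF c] chart_cpoint assms(2))
qed

lemma metric_coeff_smooth: "c \<in> atlas S \<Longrightarrow> smooth_on (cdom c) (metric_coeff S c i j)"
  using metric by (auto simp: riemannian_metric_def)

lemma metric_coeff_sym:
  assumes "c \<in> atlas S" "y \<in> cdom c"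
  shows "metric_coeff S c i j y = metric_coeff S c j i y"
  unfolding metric_coeff_def
  by (rule metric_sym) (use assms cpoint_points coord_field_in in auto)

lemma smooth_on_component: "smooth_on (D :: ((real^2) \<times> (real^2)) set) (\<lambda>z. snd z $ i)"
  by (rule smooth_on_linear) (rule bounded_linear_compose[OF bounded_linear_vec_nth bounded_linear_snd])

lemma coord_norm_sq_smooth:
  assumes "c \<in> atlas S"
  shows "smooth_on (cdom c \<times> UNIV) (coord_norm_sq c)"
proof -
  have "smooth_on (cdom c \<times> UNIV)
     (\<lambda>z :: (real^2) \<times> (real^2). \<Sum>i\<in>UNIV. \<Sum>j\<in>UNIV. metric_coeff S c i j (fst z) * snd z $ i * snd z $ j)"
    by (intro smooth_on_sum smooth_on_mult smooth_on_component smooth_on_fst metric_coeff_smooth assms) auto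
  then show ?thesis by (simp add: coord_norm_sq_def case_prod_beta')
qed

text \<open>The homogeneous extension used in \<open>geodesic_generator\<close> is, in coordinates, composition with
  division by the length; its values only involve the unit bundle.\<close>

lemma normalize_bundle_point:
  assumes "c \<in> atlas S" "y \<in> cdom c" "\<eta> \<noteq> 0"
  shows "normalize_tvec S (bundle_point S c (y, \<eta>)) = bundle_point S c (y, \<eta> /\<^sub>R sqrt (coord_norm_sq c (y, \<eta>)))"
    and "bundle_point S c (y, \<eta> /\<^sub>R sqrt (coord_norm_sq c (y, \<eta>))) \<in> unit_bundle S"
proof -
  have c: "c \<in> charts_at S (cpoint c y)" using assms cpoint_charts_at by blast
  let ?v = "tvec_of S c (cpoint c y) \<eta>"
  let ?r = "inverse (sqrt (coord_norm_sq c (y, \<eta>)))"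
  have g: "metric S (cpoint c y) ?v ?v = coord_norm_sq c (y, \<eta>)"
    by (simp add: metric_coord_norm_sq[OF c tvec_of_in[OF c]] tvec_of_chart[OF c] chart_cpoint assms(2))
  have n: "(\<lambda>d. ?r *\<^sub>R ?v d) = tcomb ?r ?v 0 ?v" by (simp add: tcomb_def)
  have "tcomb ?r ?v 0 ?v = tvec_of S c (cpoint c y) (?r *\<^sub>R \<eta>)"
    by (rule tangent_eqI[OF c]) (auto simp: c tcomb_in tvec_of_in tvec_of_chart tcomb_chart)
  note eq = n[unfolded this]
  show "normalize_tvec S (bundle_point S c (y, \<eta>)) = bundle_point S c (y, \<eta> /\<^sub>R sqrt (coord_norm_sq c (y, \<eta>)))"
    using eq by (simp add: normalize_tvec_def bundle_point_def g)
  have x: "cpoint c y \<in> points S" using c charts_at_points by blast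
  have "metric S (cpoint c y) (tcomb ?r ?v 0 ?v) (tcomb ?r ?v 0 ?v) = ?r * (?r * coord_norm_sq c (y, \<eta>))"
    by (simp add: metric_left metric_right x tvec_of_in c tcomb_in g)
  also have "\<dots> = 1"
    using coord_norm_sq_pos[OF assms] by (simp add: field_simps)
  finally show "bundle_point S c (y, \<eta> /\<^sub>R sqrt (coord_norm_sq c (y, \<eta>))) \<in> unit_bundle S"
    using x c eq n by (simp add: unit_bundle_def bundle_point_def tvec_of_in)
qed

lemma unit_bundle_nonzero:
  assumes "(x, v) \<in> unit_bundle S" "c \<in> charts_at S x"
  shows "v c \<noteq> 0"
proof
  assume "v c = 0"
  have v: "v \<in> tangent_space S x" "metric S x v v = 1" using assms by (auto simp: unit_bundle_def)
  have "metric S x v v = 0" using metric_coord_norm_sq[OF assms(2) v(1)] \<open>v c = 0\<close> by (simp add: coord_norm_sq_def)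
  then show False using v by simp
qed

lemma bundle_point_coords:
  assumes "c \<in> charts_at S x" "v \<in> tangent_space S x"
  shows "bundle_point S c (snd c x, v c) = (x, v)"
  using assms by (simp add: bundle_point_def charts_at_def cpoint_chart tvec_of_coords)

text \<open>A quarter turn in coordinates is independent of the given vector; the Gram--Schmidt step then makes
  it orthogonal.\<close>

lemma exists_orthonormal_frame:
  assumes "(x, v) \<in> unit_bundle S"
  shows "\<exists>w. orthonormal_frame S x v w"
proof -
  have v: "x \<in> points S" "v \<in> tangent_space S x" "metric S x v v = 1"
    using assms by (auto simp: unit_bundle_def)
  obtain c where c: "c \<in> charts_at S x" using v charts_at_nonempty by blast
  define \<eta> :: "real^2" where "\<eta> = vector [- (v c $ 2), v c $ 1]"
  define w where "w = tvec_of S c x \<eta>"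
  define g where "g = metric S x w v"
  define u where "u = tcomb 1 w (- g) v"
  have w: "w \<in> tangent_space S x" using c tvec_of_in w_def by blast
  have u: "u \<in> tangent_space S x" using w v tcomb_in u_def by blast
  have "u c \<noteq> 0"
  proof
    assume "u c = 0"
    then have "\<eta> = g *\<^sub>R v c" using tvec_of_chart[OF c] by (simp add: u_def w_def tcomb_chart)
    then have e: "- (v c $ 2) = g * v c $ 1" "v c $ 1 = g * v c $ 2"
      by (auto simp: \<eta>_def vec_eq_iff forall_2)
    then have "(g * g + 1) * v c $ 2 = 0" by (simp add: algebra_simps)
    then have "v c $ 2 = 0" using zero_le_square[of g] by (auto simp del: zero_le_square)
    then have "v c = 0" using e by (simp add: vec_eq_iff forall_2)
    then show False using unit_bundle_nonzero[OF assms c] by simp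
  qed
  then have pos: "metric S x u u > 0"
    using metric_pos[OF v(1) u] tangent_nonzero_iff[OF c u] by blast
  have orth: "metric S x v u = 0"
    using v w metric_sym[OF v(1) w v(2)] by (simp add: u_def metric_right g_def)
  define r where "r = inverse (sqrt (metric S x u u))"
  have "orthonormal_frame S x v (tcomb r u 0 u)"
    unfolding orthonormal_frame_def
  proof (intro conjI)
    show "tcomb r u 0 u \<in> tangent_space S x" using u tcomb_in by blast
    have "metric S x (tcomb r u 0 u) (tcomb r u 0 u) = r * (r * metric S x u u)"
      by (simp add: metric_left[OF v(1) u u tcomb_in[OF u u]] metric_right[OF v(1) u u u])
    also have "\<dots> = 1" using pos by (simp add: r_def field_simps)
    finally show "metric S x (tcomb r u 0 u) (tcomb r u 0 u) = 1" .
    show "metric S x v (tcomb r u 0 u) = 0"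
      by (simp add: metric_right[OF v(1) u u v(2)] orth)
  qed (use v in auto)
  then show ?thesis by blast
qed

text \<open>In a chart where \<open>x\<close> is an interior point, the second coordinate of the other chart would have a
  local minimum at \<open>x\<close>, so its differential would vanish; but the transition map has an
  invertible differential.\<close>

lemma boundary_chart_independent:
  assumes "c \<in> charts_at S x" "d \<in> charts_at S x" "snd d x $ 2 = 0"
  shows "snd c x $ 2 = 0"
proof (rule ccontr)
  assume "snd c x $ 2 \<noteq> 0"
  have at: "c \<in> atlas S" "d \<in> atlas S" "x \<in> fst c" "x \<in> fst d"
    using assms by (auto simp: charts_at_def)
  then have "snd c x $ 2 > 0"
    using \<open>snd c x $ 2 \<noteq> 0\<close> chart_in_half_plane[of c x] by (simp add: half_plane_def)
  obtain T where T: "open T" "snd c ` (fst c \<inter> fst d) = half_plane \<inter> T"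
    using overlap_openin[OF at(1,2)] openin_open by blast
  define V where "V = T \<inter> {y. 0 < y $ 2}"
  have V: "open V" "snd c x \<in> V" "V \<subseteq> half_plane"
  proof -
    show "open V" unfolding V_def using T(1) open_halfspace_component_gt_cart by (rule open_Int)
    have "snd c x \<in> T" using T at by blast
    then show "snd c x \<in> V" using \<open>snd c x $ 2 > 0\<close> by (simp add: V_def)
    show "V \<subseteq> half_plane" by (auto simp: V_def half_plane_def)
  qed
  have "((snd d \<circ> cpoint c) has_derivative transition_deriv c d x) (at (snd c x))"
    using transition_has_derivative[OF assms(1,2)] at_within_open_subset[OF V(2,1,3)] by simp
  from bounded_linear.has_derivative[OF bounded_linear_vec_nth this, of 2]
  have 1: "((\<lambda>y. (snd d \<circ> cpoint c) y $ 2) has_derivative (\<lambda>h. transition_deriv c d x h $ 2)) (at (snd c x))" .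
  have 2: "\<forall>y\<in>V. (snd d \<circ> cpoint c) (snd c x) $ 2 \<le> (snd d \<circ> cpoint c) y $ 2"
  proof
    fix y assume "y \<in> V"
    then have "y \<in> snd c ` (fst c \<inter> fst d)" using T V by (auto simp: V_def)
    then have "snd d (cpoint c y) \<in> half_plane"
      using at by (auto simp: cpoint_chart chart_in_half_plane)
    then show "(snd d \<circ> cpoint c) (snd c x) $ 2 \<le> (snd d \<circ> cpoint c) y $ 2"
      using assms(3) at by (simp add: half_plane_def cpoint_chart)
  qed
  have 3: "(\<lambda>h. transition_deriv c d x h $ 2) = (\<lambda>h. 0)"
    using differential_zero_maxmin[OF V(2,1) 1] 2 by blast
  have "transition_deriv c d x (transition_deriv d c x (axis 2 1)) = axis 2 1"
    using transition_cocycle[OF assms(2,1,2)] transition_self[OF assms(2)] by simp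
  moreover have "transition_deriv c d x (transition_deriv d c x (axis 2 1)) $ 2 = 0"
    using 3 by meson
  ultimately show False by (simp add: axis_def)
qed

lemma boundary_iff: "c \<in> charts_at S x \<Longrightarrow> x \<in> boundary S \<longleftrightarrow> snd c x $ 2 = 0"
  unfolding boundary_def using boundary_chart_independent charts_at_points by blast

lemma chart_continuous:
  "c \<in> atlas S \<Longrightarrow> continuous_map (subtopology (space_of S) (fst c)) euclidean (snd c)"
  using homeomorphic_imp_continuous_map[OF chart_homeo] continuous_map_into_fulltopology by blast

text \<open>Near a point off the boundary the second coordinate of a chart stays positive, and by chart
  independence it detects the boundary at every point of that chart.\<close>

lemma closedin_boundary: "closedin (space_of S) (boundary S)"
proof -
  have "openin (space_of S) (points S - boundary S)"
  proof (subst openin_subopen, safe)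
    fix x assume x: "x \<in> points S" "x \<notin> boundary S"
    obtain c where c: "c \<in> charts_at S x" using x charts_at_nonempty by blast
    have at: "c \<in> atlas S" "x \<in> fst c" using c by (auto simp: charts_at_def)
    define W where "W = {z \<in> fst c. snd c z \<in> - {y. y $ 2 = 0}}"
    have "closed {y :: real^2. y $ 2 = 0}"
      by (rule closed_Collect_eq) (auto intro!: continuous_intros)
    then have "open (- {y :: real^2. y $ 2 = 0})" by (rule open_Compl)
    then have "openin (subtopology (space_of S) (fst c)) W"
      using openin_continuous_map_preimage[OF chart_continuous[OF at(1)], of "- {y. y $ 2 = 0}"] chart_subset[OF at(1)]
      by (simp add: W_def Int_absorb1)
    then have "openin (space_of S) W"
      using chart_open[OF at(1)] openin_trans_full by blast
    moreover have "x \<in> W" using x boundary_iff[OF c] at by (simp add: W_def)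
    moreover have "W \<subseteq> points S - boundary S"
    proof
      fix z assume "z \<in> W"
      then have "c \<in> charts_at S z" "snd c z $ 2 \<noteq> 0" using at by (auto simp: W_def charts_at_def)
      then show "z \<in> points S - boundary S"
        using boundary_iff charts_at_points by blast
    qed
    ultimately show "\<exists>T. openin (space_of S) T \<and> x \<in> T \<and> T \<subseteq> points S - boundary S" by blast
  qed
  then show ?thesis by (auto simp: closedin_def boundary_def)
qed

end

section \<open>Geodesics: uniqueness and unit speed\<close>

lemma matrix_inv_eqI:
  assumes "A ** B = mat 1" "B ** A = mat 1"
  shows "matrix_inv A = B"
proof -
  have "A ** matrix_inv A = mat 1 \<and> matrix_inv A ** A = mat 1"
    unfolding matrix_inv_def by (rule someI[of _ B]) (use assms in blast)
  then show ?thesis using assms(1) matrix_mul_assoc matrix_mul_lid matrix_mul_rid by metis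
qed

lemma matrix_inv_2:
  fixes A :: "real^2^2"
  assumes "det A \<noteq> 0"
  shows "matrix_inv A = (\<chi> i j. (if i = 1 then (if j = 1 then A$2$2 else - A$1$2)
    else (if j = 1 then - A$2$1 else A$1$1)) * inverse (det A))" (is "_ = ?B")
proof -
  define d where "d = inverse (det A)"
  have "det A * d = 1" using assms by (simp add: d_def)
  then have d: "d * (A$1$1 * A$2$2) = 1 + d * (A$1$2 * A$2$1)"
    by (simp add: det_2 algebra_simps)
  have "A ** ?B = mat 1" "?B ** A = mat 1"
    unfolding d_def[symmetric]
    by (simp_all add: matrix_matrix_mult_def mat_def vec_eq_iff forall_2 sum_2 d algebra_simps)
  then show ?thesis using matrix_inv_eqI by blast
qed

text \<open>A substitute for Gronwall's inequality that works on both sides of \<open>t\<close> at once: if the interval is so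
  short that \<open>L \<bar>s - t\<bar> \<le> 1/2\<close>, the mean value inequality bounds the maximum of the norm by half of
  itself.\<close>

lemma has_vector_derivative_bound_zero:
  fixes w :: "real \<Rightarrow> 'b::real_normed_vector"
  assumes J: "compact J" "convex J" "t \<in> J" "w t = 0"
    and der: "\<And>s. s \<in> J \<Longrightarrow> (w has_vector_derivative w' s) (at s within J)"
    and bound: "\<And>s. s \<in> J \<Longrightarrow> norm (w' s) \<le> L * norm (w s)"
    and small: "\<And>s. s \<in> J \<Longrightarrow> L * \<bar>s - t\<bar> \<le> 1 / 2" and L: "L \<ge> 0"
    and s: "s \<in> J"
  shows "w s = 0"
proof -
  have "continuous_on J (\<lambda>s. norm (w s))"
    by (intro continuous_on_norm) (meson der continuous_on_vector_derivative)
  then obtain m where m: "m \<in> J" "\<And>s. s \<in> J \<Longrightarrow> norm (w s) \<le> norm (w m)"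
    using continuous_attains_sup[OF J(1)] J(3) by blast
  have "norm (w m - w t) \<le> (L * norm (w m)) * norm (m - t)"
  proof (rule differentiable_bound[OF J(2)])
    fix s assume s: "s \<in> J"
    show "(w has_derivative (\<lambda>h. h *\<^sub>R w' s)) (at s within J)"
      using der[OF s] by (simp add: has_vector_derivative_def)
    show "onorm (\<lambda>h. h *\<^sub>R w' s) \<le> L * norm (w m)"
    proof (rule onorm_le)
      fix h
      have "norm (w' s) \<le> L * norm (w m)"
        using bound[OF s] mult_left_mono[OF m(2)[OF s] L] by linarith
      then show "norm (h *\<^sub>R w' s) \<le> L * norm (w m) * norm h"
        by (simp add: mult.commute mult_left_mono)
    qed
  qed (use J m in auto)
  also have "\<dots> = (L * \<bar>m - t\<bar>) * norm (w m)" by (simp add: mult_ac)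
  also have "\<dots> \<le> 1 / 2 * norm (w m)"
    using small[OF m(1)] by (intro mult_right_mono) auto
  finally have "norm (w m) \<le> 0" using J(4) by simp
  then show ?thesis using m(2)[OF s] by simp
qed

lemma geodesic_restrict:
  assumes "geodesic S T \<zeta>" "0 \<le> t" "t \<le> T"
  shows "geodesic S t \<zeta>"
proof -
  have sub: "{0..t} \<subseteq> {0..T}" using assms by auto
  have "continuous_map (top_of_set {0..t}) (space_of S) (fst \<circ> \<zeta>)"
    using assms(1) continuous_map_from_subtopology_mono[OF _ sub] by (auto simp: geodesic_def)
  then show ?thesis
    using assms sub has_vector_derivative_within_subset[OF _ sub]
    unfolding geodesic_def by (meson subsetD)
qed

lemma geodesic_shift:
  assumes "geodesic S T \<zeta>" "0 \<le> t" "t \<le> T"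
  shows "geodesic S (T - t) (\<lambda>s. \<zeta> (t + s))"
proof -
  have im: "(+) t ` {0..T - t} \<subseteq> {0..T}" using assms by auto
  have cm: "continuous_map (top_of_set {0..T - t}) (top_of_set {0..T}) ((+) t)"
    using im by (auto intro!: continuous_intros)
  have shift: "((\<lambda>s. f (t + s)) has_vector_derivative f') (at s within {0..T - t})"
    if "(f has_vector_derivative f') (at (t + s) within {0..T})" for f :: "real \<Rightarrow> real^2" and f' s
  proof -
    have 1: "((+) t has_vector_derivative 1) (at s within {0..T - t})"
      by (auto intro!: derivative_eq_intros)
    have "(f has_vector_derivative f') (at (t + s) within (+) t ` {0..T - t})"
      using that has_vector_derivative_within_subset[OF _ im] by blast
    from vector_diff_chain_within[OF 1 this] show ?thesis by (simp add: o_def)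
  qed
  have "continuous_map (top_of_set {0..T - t}) (space_of S) ((fst \<circ> \<zeta>) \<circ> (+) t)"
    using assms(1) continuous_map_compose[OF cm] by (auto simp: geodesic_def)
  then have "continuous_map (top_of_set {0..T - t}) (space_of S) (fst \<circ> (\<lambda>s. \<zeta> (t + s)))"
    by (simp add: o_def)
  moreover have "t + s \<in> {0..T}" if "s \<in> {0..T - t}" for s using that assms by auto
  ultimately show ?thesis
    using assms unfolding geodesic_def
    by (auto intro!: shift)
qed

context riemannian_surface
begin

definition geodesic_field :: "'a chart \<Rightarrow> (real^2) \<times> (real^2) \<Rightarrow> (real^2) \<times> (real^2)" where
  "geodesic_field c = (\<lambda>(y, \<eta>). (\<eta>, - christoffel_form S c y \<eta> \<eta>))"

definition coords :: "'a chart \<Rightarrow> 'a \<times> 'a tvec \<Rightarrow> (real^2) \<times> (real^2)" where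
  "coords c = (\<lambda>(x, v). (snd c x, v c))"

lemma det_metric_matrix_pos:
  assumes "c \<in> atlas S" "y \<in> cdom c"
  shows "det (metric_matrix S c y) > 0"
proof -
  let ?g = "\<lambda>i j. metric_coeff S c i j y"
  have sym: "?g 2 1 = ?g 1 2" using metric_coeff_sym assms by blast
  have 1: "?g 1 1 > 0"
    using coord_norm_sq_pos[OF assms, of "vector [1, 0]"]
    by (simp add: coord_norm_sq_def sum_2 vec_eq_iff forall_2)
  \<comment> \<open>the vector orthogonal to the first coordinate vector\<close>
  have "coord_norm_sq c (y, vector [- ?g 1 2, ?g 1 1]) > 0"
    using coord_norm_sq_pos[OF assms, of "vector [- ?g 1 2, ?g 1 1]"] 1
    by (simp add: vec_eq_iff forall_2)
  also have "coord_norm_sq c (y, vector [- ?g 1 2, ?g 1 1]) = ?g 1 1 * det (metric_matrix S c y)"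
    using sym by (simp add: coord_norm_sq_def sum_2 det_2 metric_matrix_def algebra_simps)
  finally show ?thesis using 1 by (simp add: zero_less_mult_iff)
qed

lemma matrix_inv_metric_smooth:
  assumes "c \<in> atlas S"
  shows "smooth_on (cdom c) (\<lambda>y. matrix_inv (metric_matrix S c y) $ k $ l)"
proof -
  have det: "smooth_on (cdom c) (\<lambda>y. inverse (det (metric_matrix S c y)))"
  proof (rule smooth_on_inverse)
    show "smooth_on (cdom c) (\<lambda>y. det (metric_matrix S c y))"
      unfolding det_2 metric_matrix_def vec_lambda_beta
      by (intro smooth_on_diff smooth_on_mult metric_coeff_smooth assms)
  qed (use det_metric_matrix_pos[OF assms] in force)
  have "smooth_on (cdom c) (\<lambda>y. (if k = 1 then (if l = 1 then metric_coeff S c 2 2 y else - metric_coeff S c 1 2 y)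
    else (if l = 1 then - metric_coeff S c 2 1 y else metric_coeff S c 1 1 y)) * inverse (det (metric_matrix S c y)))"
    by (cases "k = 1"; cases "l = 1")
      (auto intro!: smooth_on_mult smooth_on_uminus metric_coeff_smooth assms det)
  then show ?thesis
  proof (rule smooth_on_cong)
    fix y assume "y \<in> cdom c"
    then have "det (metric_matrix S c y) \<noteq> 0" using det_metric_matrix_pos[OF assms] by fastforce
    then show "(if k = 1 then (if l = 1 then metric_coeff S c 2 2 y else - metric_coeff S c 1 2 y)
    else (if l = 1 then - metric_coeff S c 2 1 y else metric_coeff S c 1 1 y)) * inverse (det (metric_matrix S c y))
     = matrix_inv (metric_matrix S c y) $ k $ l"
      by (simp add: matrix_inv_2) (simp add: metric_matrix_def)
  qed
qed

lemma metric_coeff_deriv_smooth: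
  "c \<in> atlas S \<Longrightarrow> smooth_on (cdom c) (metric_coeff_deriv S c l i j)"
  unfolding metric_coeff_deriv_def
  using smooth_on_frechet_derivative[OF metric_coeff_smooth cdom_openin] by blast

lemma metric_coeff_deriv_sym:
  assumes "c \<in> atlas S" "y \<in> cdom c"
  shows "metric_coeff_deriv S c l i j y = metric_coeff_deriv S c l j i y"
proof -
  have "(metric_coeff S c j i has_derivative frechet_derivative (metric_coeff S c j i) (at y within cdom c))
      (at y within cdom c)"
    using smooth_on_imp_differentiable[OF metric_coeff_smooth] assms frechet_derivative_works by blast
  then have "(metric_coeff S c i j has_derivative frechet_derivative (metric_coeff S c j i) (at y within cdom c))
      (at y within cdom c)"
    by (rule has_derivative_transform[rotated 2]) (use assms metric_coeff_sym in auto)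
  then show ?thesis
    by (simp add: metric_coeff_deriv_def frechet_derivative_half_plane[OF cdom_openin[OF assms(1)] assms(2)])
qed

lemma christoffel_smooth:
  assumes "c \<in> atlas S"
  shows "smooth_on (cdom c) (\<lambda>y. christoffel S c y k i j)"
  unfolding christoffel_def divide_inverse
  by (intro smooth_on_mult smooth_on_const smooth_on_sum smooth_on_diff smooth_on_add
      matrix_inv_metric_smooth metric_coeff_deriv_smooth assms finite)

lemma geodesic_field_smooth:
  assumes "c \<in> atlas S"
  shows "smooth_on (cdom c \<times> UNIV) (geodesic_field c)"
proof -
  define \<Gamma> where "\<Gamma> k z = (\<Sum>i\<in>UNIV. \<Sum>j\<in>UNIV. christoffel S c (fst z) k i j * snd z $ i * snd z $ j)"
    for k and z :: "(real^2) \<times> (real^2)"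
  have \<Gamma>: "smooth_on (cdom c \<times> UNIV) (\<Gamma> k)" for k
    unfolding \<Gamma>_def
    by (intro smooth_on_sum smooth_on_mult smooth_on_component
        smooth_on_fst[OF christoffel_smooth] assms finite)
  have "smooth_on (cdom c \<times> UNIV) (\<lambda>z :: (real^2) \<times> (real^2). (snd z, 0 :: real^2)
      - (\<Sum>k\<in>UNIV. \<Gamma> k z *\<^sub>R (0 :: real^2, axis k 1 :: real^2)))"
    by (intro smooth_on_diff smooth_on_sum smooth_on_scaleR \<Gamma> smooth_on_const finite smooth_on_linear)
      (intro bounded_linear_Pair bounded_linear_snd bounded_linear_zero)
  then show ?thesis
    by (rule smooth_on_cong)
      (auto simp: geodesic_field_def christoffel_form_def \<Gamma>_def sum_2 vec_eq_iff forall_2 axis_def)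
qed

text \<open>Lowering the upper index removes the inverse matrix.  Only this form of the Christoffel symbols
  enters the conservation of speed.\<close>

lemma christoffel_contract:
  assumes "c \<in> atlas S" "y \<in> cdom c"
  shows "(\<Sum>k\<in>UNIV. metric_coeff S c n k y * christoffel S c y k i j) =
    (metric_coeff_deriv S c i j n y + metric_coeff_deriv S c j i n y - metric_coeff_deriv S c n i j y) / 2"
proof -
  have inv: "metric_matrix S c y ** matrix_inv (metric_matrix S c y) = mat 1"
    using det_metric_matrix_pos[OF assms] matrix_inv_eqI invertible_def invertible_det_nz
    by (metis less_irrefl)
  have d: "(\<Sum>k\<in>UNIV. metric_coeff S c n k y * matrix_inv (metric_matrix S c y) $ k $ l) = (if n = l then 1 else 0)" for l
    using arg_cong[OF inv, of "\<lambda>M. M $ n $ l"]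
    by (simp add: matrix_matrix_mult_def mat_def metric_matrix_def)
  define d where "d l = metric_coeff_deriv S c i j l y + metric_coeff_deriv S c j i l y - metric_coeff_deriv S c l i j y" for l
  have "(\<Sum>k\<in>UNIV. metric_coeff S c n k y * christoffel S c y k i j) =
     (\<Sum>k\<in>UNIV. \<Sum>l\<in>UNIV. metric_coeff S c n k y * matrix_inv (metric_matrix S c y) $ k $ l * d l) / 2"
    by (simp add: christoffel_def d_def sum_distrib_left sum_divide_distrib mult.assoc)
  also have "\<dots> = (\<Sum>l\<in>UNIV. (\<Sum>k\<in>UNIV. metric_coeff S c n k y * matrix_inv (metric_matrix S c y) $ k $ l) * d l) / 2"
    by (subst sum.swap) (simp add: sum_distrib_right)
  also have "\<dots> = d n / 2" by (simp add: d if_distrib[of "\<lambda>x. x * _"] cong: if_cong)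
  finally show ?thesis by (simp add: d_def)
qed

lemma geodesicD:
  assumes "geodesic S T \<zeta>" "t \<in> {0..T}"
  shows "snd (\<zeta> t) \<in> tangent_space S (fst (\<zeta> t))" "fst (\<zeta> t) \<in> points S"
proof -
  have "continuous_map (top_of_set {0..T}) (space_of S) (fst \<circ> \<zeta>)"
    using assms by (auto simp: geodesic_def)
  from continuous_map_image_subset_topspace[OF this] assms(2)
  show "fst (\<zeta> t) \<in> points S" by auto
qed (use assms in \<open>auto simp: geodesic_def\<close>)

lemma geodesic_coords_derivative:
  assumes "geodesic S T \<zeta>" "t \<in> {0..T}" "c \<in> charts_at S (fst (\<zeta> t))"
  shows "((\<lambda>s. coords c (\<zeta> s)) has_vector_derivative geodesic_field c (coords c (\<zeta> t))) (at t within {0..T})"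
proof -
  have "((\<lambda>s. snd c (fst (\<zeta> s))) has_vector_derivative snd (\<zeta> t) c) (at t within {0..T})"
    "((\<lambda>s. snd (\<zeta> s) c) has_vector_derivative
              - christoffel_form S c (snd c (fst (\<zeta> t))) (snd (\<zeta> t) c) (snd (\<zeta> t) c))
             (at t within {0..T})"
    using assms by (auto simp: geodesic_def)
  from has_vector_derivative_Pair[OF this] show ?thesis
    by (simp add: coords_def geodesic_field_def case_prod_beta)
qed

lemma geodesic_stays_in_chart:
  assumes "geodesic S T \<zeta>" "t \<in> {0..T}" "c \<in> charts_at S (fst (\<zeta> t))"
  obtains e where "e > 0" "\<And>s. s \<in> {0..T} \<Longrightarrow> \<bar>s - t\<bar> < e \<Longrightarrow> c \<in> charts_at S (fst (\<zeta> s))"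
proof -
  have c: "c \<in> atlas S" "fst (\<zeta> t) \<in> fst c" using assms by (auto simp: charts_at_def)
  have "continuous_map (top_of_set {0..T}) (space_of S) (fst \<circ> \<zeta>)"
    using assms by (auto simp: geodesic_def)
  from openin_continuous_map_preimage[OF this chart_open[OF c(1)]]
  have "openin (top_of_set {0..T}) {s \<in> {0..T}. fst (\<zeta> s) \<in> fst c}" by simp
  moreover have "t \<in> {s \<in> {0..T}. fst (\<zeta> s) \<in> fst c}" using assms c by simp
  ultimately obtain e where "e > 0" "\<forall>s\<in>{0..T}. dist s t < e \<longrightarrow> s \<in> {s \<in> {0..T}. fst (\<zeta> s) \<in> fst c}"
    unfolding openin_euclidean_subtopology_iff by blast
  then show thesis using c that by (auto simp: dist_real_def charts_at_def)
qed

text \<open>Derivatives at \<open>t\<close> within \<open>J\<close> and within the whole interval coincide, so the computations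
  along a geodesic can be made in a single chart.\<close>

lemma geodesic_chart_nbhd:
  assumes "geodesic S T \<zeta>" "t \<in> {0..T}" "c \<in> charts_at S (fst (\<zeta> t))"
  obtains J where "t \<in> J" "J \<subseteq> {0..T}" "at t within J = at t within {0..T}"
    "\<And>s. s \<in> J \<Longrightarrow> c \<in> charts_at S (fst (\<zeta> s))"
proof -
  obtain e where e: "e > 0" "\<And>r. r \<in> {0..T} \<Longrightarrow> \<bar>r - t\<bar> < e \<Longrightarrow> c \<in> charts_at S (fst (\<zeta> r))"
    using geodesic_stays_in_chart[OF assms] by metis
  have "at t within {0..T} \<inter> ball t e = at t within {0..T}"
    by (rule at_within_nhd[of _ "ball t e"]) (use e in auto)
  moreover have "c \<in> charts_at S (fst (\<zeta> s))" if "s \<in> {0..T} \<inter> ball t e" for s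
    using e(2)[of s] that by (auto simp: dist_real_def abs_minus_commute)
  ultimately show thesis using that[of "{0..T} \<inter> ball t e"] assms(2) e(1) by simp
qed

lemma coords_in:
  "c \<in> charts_at S x \<Longrightarrow> coords c (x, v) \<in> cdom c \<times> UNIV"
  by (simp add: coords_def chart_in_cdom charts_at_atlas(2))

lemma coords_inj:
  assumes "c \<in> charts_at S (fst \<xi>)" "c \<in> charts_at S (fst \<xi>')"
    "snd \<xi> \<in> tangent_space S (fst \<xi>)" "snd \<xi>' \<in> tangent_space S (fst \<xi>')" "coords c \<xi> = coords c \<xi>'"
  shows "\<xi> = \<xi>'"
proof -
  have b: "bundle_point S c (coords c \<zeta>) = \<zeta>"
    if "c \<in> charts_at S (fst \<zeta>)" "snd \<zeta> \<in> tangent_space S (fst \<zeta>)" for \<zeta>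
    using bundle_point_coords[OF that] by (simp add: coords_def case_prod_beta)
  have "\<xi> = bundle_point S c (coords c \<xi>)" by (rule b[OF assms(1,3), symmetric])
  also have "\<dots> = bundle_point S c (coords c \<xi>')" by (rule arg_cong[OF assms(5)])
  also have "\<dots> = \<xi>'" by (rule b[OF assms(2,4)])
  finally show ?thesis .
qed

text \<open>In a chart the coordinates of both geodesics solve the same differential equation, whose right-hand
  side is Lipschitz near the common value at \<open>t\<close>.\<close>

lemma geodesic_agree_open:
  assumes g: "geodesic S T \<zeta>1" "geodesic S T \<zeta>2" and t: "t \<in> {0..T}" and eq: "\<zeta>1 t = \<zeta>2 t"
  shows "\<exists>e>0. \<forall>s\<in>{0..T}. \<bar>s - t\<bar> < e \<longrightarrow> \<zeta>1 s = \<zeta>2 s"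
proof -
  obtain c where c: "c \<in> charts_at S (fst (\<zeta>1 t))" using charts_at_nonempty geodesicD[OF g(1) t] by blast
  have c2: "c \<in> charts_at S (fst (\<zeta>2 t))" using c eq by simp
  have cat: "c \<in> atlas S" using c charts_at_atlas by blast
  define z1 where "z1 s = coords c (\<zeta>1 s)" for s
  define z2 where "z2 s = coords c (\<zeta>2 s)" for s
  obtain e1 where e1: "e1 > 0" "\<And>s. s \<in> {0..T} \<Longrightarrow> \<bar>s - t\<bar> < e1 \<Longrightarrow> c \<in> charts_at S (fst (\<zeta>1 s))"
    using geodesic_stays_in_chart[OF g(1) t c] by metis
  obtain e2 where e2: "e2 > 0" "\<And>s. s \<in> {0..T} \<Longrightarrow> \<bar>s - t\<bar> < e2 \<Longrightarrow> c \<in> charts_at S (fst (\<zeta>2 s))"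
    using geodesic_stays_in_chart[OF g(2) t c2] by metis
  have z0: "z1 t \<in> cdom c \<times> UNIV" using coords_in[OF c] by (simp add: z1_def coords_def case_prod_beta)
  obtain r L where rL: "r > 0" "L \<ge> 0"
    "\<And>y z. y \<in> cdom c \<times> UNIV \<inter> ball (z1 t) r \<Longrightarrow> z \<in> cdom c \<times> UNIV \<inter> ball (z1 t) r \<Longrightarrow>
       norm (geodesic_field c y - geodesic_field c z) \<le> L * norm (y - z)"
    using smooth_on_locally_Lipschitz[OF geodesic_field_smooth[OF cat] z0] by metis
  have near: "\<exists>e>0. \<forall>s\<in>{0..T}. \<bar>s - t\<bar> < e \<longrightarrow> coords c (\<zeta> s) \<in> ball (z1 t) r"
    if "geodesic S T \<zeta>" "\<zeta> t = \<zeta>1 t" for \<zeta>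
  proof -
    have "continuous (at t within {0..T}) (\<lambda>s. coords c (\<zeta> s))"
      using geodesic_coords_derivative[OF that(1) t] c that(2) has_vector_derivative_continuous by metis
    then obtain e where "e > 0" "\<forall>s\<in>{0..T}. dist s t < e \<longrightarrow> dist (coords c (\<zeta> s)) (coords c (\<zeta> t)) < r"
      unfolding continuous_within_eps_delta using rL(1) by blast
    then show ?thesis using that(2) by (auto simp: z1_def dist_real_def dist_commute intro!: exI[of _ e])
  qed
  obtain e3 where e3: "e3 > 0" "\<And>s. s \<in> {0..T} \<Longrightarrow> \<bar>s - t\<bar> < e3 \<Longrightarrow> z1 s \<in> ball (z1 t) r"
    using near[OF g(1)] by (auto simp: z1_def)
  obtain e4 where e4: "e4 > 0" "\<And>s. s \<in> {0..T} \<Longrightarrow> \<bar>s - t\<bar> < e4 \<Longrightarrow> z2 s \<in> ball (z1 t) r"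
    using near[OF g(2)] eq by (auto simp: z2_def)
  (* the last entry yields L * \<bar>s - t\<bar> \<le> 1/2 as required by has_vector_derivative_bound_zero *)
  define e where "e = Min {e1/2, e2/2, e3/2, e4/2, 1 / (2 * (L + 1))}"
  have e: "e > 0" "e < e1" "e < e2" "e < e3" "e < e4" "e \<le> 1 / (2 * (L + 1))"
    using e1 e2 e3 e4 rL(2) by (auto simp: e_def min_def)
  define J where "J = {0..T} \<inter> cball t e"
  have Jin: "s \<in> {0..T}" "\<bar>s - t\<bar> \<le> e" if "s \<in> J" for s
    using that by (auto simp: J_def dist_real_def)
  have chart: "c \<in> charts_at S (fst (\<zeta>1 s))" "c \<in> charts_at S (fst (\<zeta>2 s))" if "s \<in> J" for s
    using e1(2)[of s] e2(2)[of s] Jin[OF that] e by auto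
  have ball: "z1 s \<in> cdom c \<times> UNIV \<inter> ball (z1 t) r" "z2 s \<in> cdom c \<times> UNIV \<inter> ball (z1 t) r" if "s \<in> J" for s
    using e3(2)[of s] e4(2)[of s] Jin[OF that] e coords_in[OF chart(1)[OF that]] coords_in[OF chart(2)[OF that]]
    by (auto simp: z1_def z2_def coords_def case_prod_beta)
  have zero: "z1 s - z2 s = 0" if "s \<in> J" for s
  proof (rule has_vector_derivative_bound_zero[where J = J and t = t and L = L
        and w' = "\<lambda>s. geodesic_field c (z1 s) - geodesic_field c (z2 s)"])
    show "compact J" "convex J" by (auto simp: J_def compact_Int convex_Int)
    show "t \<in> J" using t e by (auto simp: J_def)
    show "z1 t - z2 t = 0" using eq by (simp add: z1_def z2_def)
    fix u assume u: "u \<in> J"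
    have "(z1 has_vector_derivative geodesic_field c (z1 u)) (at u within {0..T})"
      "(z2 has_vector_derivative geodesic_field c (z2 u)) (at u within {0..T})"
      unfolding z1_def z2_def using geodesic_coords_derivative g Jin(1)[OF u] chart[OF u] by blast+
    then have "((\<lambda>s. z1 s - z2 s) has_vector_derivative geodesic_field c (z1 u) - geodesic_field c (z2 u)) (at u within {0..T})"
      by (rule has_vector_derivative_diff)
    then show "((\<lambda>s. z1 s - z2 s) has_vector_derivative geodesic_field c (z1 u) - geodesic_field c (z2 u)) (at u within J)"
      by (rule has_vector_derivative_within_subset) (auto simp: J_def)
    show "norm (geodesic_field c (z1 u) - geodesic_field c (z2 u)) \<le> L * norm (z1 u - z2 u)"
      by (rule rL(3)[OF ball(1)[OF u] ball(2)[OF u]])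
    have "L * \<bar>u - t\<bar> \<le> L * (1 / (2 * (L + 1)))"
      using Jin(2)[OF u] e(6) rL(2) by (intro mult_left_mono) auto
    also have "\<dots> \<le> 1 / 2" using rL(2) by (simp add: field_simps)
    finally show "L * \<bar>u - t\<bar> \<le> 1 / 2" .
  qed (use rL that in auto)
  have "\<zeta>1 s = \<zeta>2 s" if "s \<in> {0..T}" "\<bar>s - t\<bar> < e" for s
  proof -
    have s: "s \<in> J" using that by (auto simp: J_def dist_real_def)
    show ?thesis
      by (rule coords_inj[OF chart[OF s]])
        (use geodesicD(1) g that zero[OF s] in \<open>auto simp: z1_def z2_def\<close>)
  qed
  then show ?thesis using e(1) by blast
qed

text \<open>The base points agree in the limit because the surface is Hausdorff; only then is there a common
  chart in which the velocities can be compared.\<close>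

lemma geodesic_agree_closed:
  assumes g: "geodesic S T \<zeta>1" "geodesic S T \<zeta>2" and t: "t \<in> {0..T}"
    and lim: "t islimpt {s \<in> {0..T}. \<zeta>1 s = \<zeta>2 s}"
  shows "\<zeta>1 t = \<zeta>2 t"
proof -
  let ?E = "{s \<in> {0..T}. \<zeta>1 s = \<zeta>2 s}"
  have "Hausdorff_space (space_of S)" using smooth by (simp add: smooth_surface_def)
  then have "closedin (top_of_set {0..T}) {s \<in> topspace (top_of_set {0..T}). (fst \<circ> \<zeta>1) s = (fst \<circ> \<zeta>2) s}"
    by (rule closedin_continuous_maps_eq) (use g in \<open>auto simp only: geodesic_def\<close>)
  then have cl: "closedin (top_of_set {0..T}) {s \<in> {0..T}. fst (\<zeta>1 s) = fst (\<zeta>2 s)}" by simp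
  have "t islimpt {s \<in> {0..T}. fst (\<zeta>1 s) = fst (\<zeta>2 s)}"
    by (rule islimpt_subset[OF lim]) auto
  then have x: "fst (\<zeta>1 t) = fst (\<zeta>2 t)"
    using cl t unfolding closedin_limpt by blast
  obtain c where c: "c \<in> charts_at S (fst (\<zeta>1 t))" using charts_at_nonempty geodesicD[OF g(1) t] by blast
  have c2: "c \<in> charts_at S (fst (\<zeta>2 t))" using c x by simp
  have lims: "((\<lambda>s. coords c (\<zeta> s)) \<longlongrightarrow> coords c (\<zeta> t)) (at t within ?E)"
    if "geodesic S T \<zeta>" "c \<in> charts_at S (fst (\<zeta> t))" for \<zeta>
  proof -
    have "continuous (at t within {0..T}) (\<lambda>s. coords c (\<zeta> s))"
      using geodesic_coords_derivative[OF that(1) t that(2)] has_vector_derivative_continuous by metis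
    then have "continuous (at t within ?E) (\<lambda>s. coords c (\<zeta> s))"
      by (rule continuous_within_subset) auto
    then show ?thesis by (simp add: continuous_within)
  qed
  have "((\<lambda>s. coords c (\<zeta>2 s)) \<longlongrightarrow> coords c (\<zeta>1 t)) (at t within ?E)"
    using lims[OF g(1) c] by (rule Lim_transform_eventually) (auto simp: eventually_at_filter)
  moreover have "at t within ?E \<noteq> bot" using lim trivial_limit_within[of t ?E] by blast
  ultimately have "coords c (\<zeta>1 t) = coords c (\<zeta>2 t)"
    using lims[OF g(2) c2] tendsto_unique by blast
  then show ?thesis using coords_inj[OF c c2] geodesicD(1) g t by blast
qed

text \<open>The set of times of agreement is open, closed and nonempty in an interval.\<close>

theorem geodesic_unique:
  assumes g: "geodesic S T \<zeta>1" "geodesic S T \<zeta>2" and eq: "\<zeta>1 0 = \<zeta>2 0" and t: "t \<in> {0..T}"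
  shows "\<zeta>1 t = \<zeta>2 t"
proof -
  let ?E = "{s \<in> {0..T}. \<zeta>1 s = \<zeta>2 s}"
  have "openin (top_of_set {0..T}) ?E"
    unfolding openin_euclidean_subtopology_iff
    using geodesic_agree_open[OF g] by (auto simp: dist_real_def)
  moreover have "closedin (top_of_set {0..T}) ?E"
    unfolding closedin_limpt using geodesic_agree_closed[OF g] by blast
  moreover have "connected {0..T}" by simp
  moreover have "0 \<in> ?E" using t eq by auto
  ultimately have "?E = {0..T}" unfolding connected_clopen by blast
  then show ?thesis using t by blast
qed

lemma geodesic_flow_eq:
  assumes "geodesic S T \<zeta>" "0 \<le> t" "t \<le> T"
  shows "geodesic_flow S t (\<zeta> 0) = \<zeta> t"
  unfolding geodesic_flow_def
proof (rule the_equality)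
  have g: "geodesic S t \<zeta>" using geodesic_restrict assms by blast
  then show "\<exists>\<zeta>'. geodesic S t \<zeta>' \<and> \<zeta>' 0 = \<zeta> 0 \<and> \<zeta>' t = \<zeta> t" by blast
  fix z assume "\<exists>\<zeta>'. geodesic S t \<zeta>' \<and> \<zeta>' 0 = \<zeta> 0 \<and> \<zeta>' t = z"
  then show "z = \<zeta> t" using geodesic_unique[OF g, of _ t] assms(2) by fastforce
qed

lemma geodesic_flow_shift:
  assumes "geodesic S T \<zeta>" "0 \<le> t" "0 \<le> s" "t + s \<le> T"
  shows "geodesic_flow S s (\<zeta> t) = \<zeta> (t + s)"
  using geodesic_flow_eq[OF geodesic_shift[OF assms(1,2)], of s] assms by simp

text \<open>Differentiating \<open>g\<^sub>i\<^sub>j \<eta>\<^sup>i \<eta>\<^sup>j\<close> along the curve gives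
  \<open>\<partial>\<^sub>l g\<^sub>i\<^sub>j \<eta>\<^sup>l \<eta>\<^sup>i \<eta>\<^sup>j - 2 g\<^sub>n\<^sub>k \<Gamma>\<^sup>k\<^sub>i\<^sub>j \<eta>\<^sup>n \<eta>\<^sup>i \<eta>\<^sup>j\<close>.  By \<open>christoffel_contract\<close> the second term is the
  first one, up to the names of the summation indices.\<close>

lemma geodesic_unit_speed:
  assumes g: "geodesic S T \<zeta>" and u: "\<zeta> 0 \<in> unit_bundle S" and t: "t \<in> {0..T}"
  shows "\<zeta> t \<in> unit_bundle S"
proof -
  define f where "f s = metric S (fst (\<zeta> s)) (snd (\<zeta> s)) (snd (\<zeta> s))" for s
  have "(f has_vector_derivative 0) (at s within {0..T})" if s: "s \<in> {0..T}" for s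
  proof -
    obtain c where c: "c \<in> charts_at S (fst (\<zeta> s))" using charts_at_nonempty geodesicD[OF g s] by blast
    have cat: "c \<in> atlas S" using c charts_at_atlas by blast
    obtain J where sJ: "s \<in> J" and Jsub: "J \<subseteq> {0..T}" and Jat: "at s within J = at s within {0..T}"
      and Jc: "\<And>r. r \<in> J \<Longrightarrow> c \<in> charts_at S (fst (\<zeta> r))"
      using geodesic_chart_nbhd[OF g s c] by metis
    define y where "y r = snd c (fst (\<zeta> r))" for r
    define \<eta> where "\<eta> r = snd (\<zeta> r) c" for r
    define \<Gamma> where "\<Gamma> = christoffel_form S c (y s) (\<eta> s) (\<eta> s)"
    have y: "y s \<in> cdom c" by (simp add: y_def chart_in_cdom charts_at_atlas(2)[OF c])
    have yJ: "y ` J \<subseteq> cdom c" by (auto simp: y_def intro!: chart_in_cdom charts_at_atlas(2) Jc)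
    have dy: "(y has_vector_derivative \<eta> s) (at s within J)"
      and d\<eta>: "(\<eta> has_vector_derivative - \<Gamma>) (at s within J)"
      using g s c unfolding Jat by (auto simp: geodesic_def y_def[abs_def] \<eta>_def[abs_def] \<Gamma>_def)
    have d\<eta>i: "((\<lambda>r. \<eta> r $ i) has_real_derivative - (\<Gamma> $ i)) (at s within J)" for i
      using bounded_linear.has_vector_derivative[OF bounded_linear_vec_nth d\<eta>, of i]
      by (simp add: has_real_derivative_iff_has_vector_derivative)
    have dg: "((\<lambda>r. metric_coeff S c i j (y r)) has_real_derivative
        (\<Sum>l\<in>UNIV. metric_coeff_deriv S c l i j (y s) * \<eta> s $ l)) (at s within J)" for i j
    proof -
      let ?D = "frechet_derivative (metric_coeff S c i j) (at (y s) within cdom c)"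
      have D: "(metric_coeff S c i j has_derivative ?D) (at (y s) within cdom c)"
        using smooth_on_imp_differentiable[OF metric_coeff_smooth[OF cat] y] frechet_derivative_works by blast
      have "((metric_coeff S c i j \<circ> y) has_derivative ?D \<circ> (\<lambda>h. h *\<^sub>R \<eta> s)) (at s within J)"
        using diff_chain_within[OF dy[unfolded has_vector_derivative_def] has_derivative_subset[OF D yJ]] .
      moreover have "?D \<circ> (\<lambda>h. h *\<^sub>R \<eta> s) = (\<lambda>h. h *\<^sub>R ?D (\<eta> s))"
        using has_derivative_linear[OF D] by (auto simp: linear_scale)
      ultimately have "((metric_coeff S c i j \<circ> y) has_vector_derivative ?D (\<eta> s)) (at s within J)"
        by (simp add: has_vector_derivative_def)
      moreover have "?D (\<eta> s) = (\<Sum>l\<in>UNIV. metric_coeff_deriv S c l i j (y s) * \<eta> s $ l)"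
      proof -
        have "\<eta> s = (\<Sum>l\<in>UNIV. \<eta> s $ l *\<^sub>R axis l 1)"
          by (simp add: vec_eq_iff sum_2 forall_2 axis_def)
        then have "?D (\<eta> s) = ?D (\<Sum>l\<in>UNIV. \<eta> s $ l *\<^sub>R axis l 1)" by simp
        also have "\<dots> = (\<Sum>l\<in>UNIV. \<eta> s $ l *\<^sub>R ?D (axis l 1))"
          using has_derivative_linear[OF D] by (simp add: linear_sum linear_scale)
        finally show ?thesis by (simp add: metric_coeff_deriv_def mult.commute)
      qed
      ultimately show ?thesis
        by (simp add: has_real_derivative_iff_has_vector_derivative o_def)
    qed
    have con: "metric_coeff S c n 1 (y s) * \<Gamma> $ 1 + metric_coeff S c n 2 (y s) * \<Gamma> $ 2 =
       (\<Sum>i\<in>UNIV. \<Sum>j\<in>UNIV. ((metric_coeff_deriv S c i j n (y s) + metric_coeff_deriv S c j i n (y s)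
          - metric_coeff_deriv S c n i j (y s)) / 2) * \<eta> s $ i * \<eta> s $ j)" for n
      unfolding christoffel_contract[OF cat y, symmetric] \<Gamma>_def christoffel_form_def
      by (simp add: sum_2 algebra_simps)
    have symd: "metric_coeff_deriv S c l 2 1 (y s) = metric_coeff_deriv S c l 1 2 (y s)" for l
      using metric_coeff_deriv_sym[OF cat y] .
    have "((\<lambda>r. coord_norm_sq c (y r, \<eta> r)) has_real_derivative
      (\<Sum>i\<in>UNIV. \<Sum>j\<in>UNIV. (\<Sum>l\<in>UNIV. metric_coeff_deriv S c l i j (y s) * \<eta> s $ l) * \<eta> s $ i * \<eta> s $ j
         - metric_coeff S c i j (y s) * \<Gamma> $ i * \<eta> s $ j - metric_coeff S c i j (y s) * \<eta> s $ i * \<Gamma> $ j)) (at s within J)"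
      unfolding coord_norm_sq_def case_prod_conv
    proof (intro DERIV_sum)
      fix i j :: 2
      show "((\<lambda>r. metric_coeff S c i j (y r) * \<eta> r $ i * \<eta> r $ j) has_real_derivative
        (\<Sum>l\<in>UNIV. metric_coeff_deriv S c l i j (y s) * \<eta> s $ l) * \<eta> s $ i * \<eta> s $ j
         - metric_coeff S c i j (y s) * \<Gamma> $ i * \<eta> s $ j - metric_coeff S c i j (y s) * \<eta> s $ i * \<Gamma> $ j)
        (at s within J)"
        by (rule DERIV_cong[OF DERIV_mult[OF DERIV_mult[OF dg d\<eta>i] d\<eta>i]]) (simp add: algebra_simps)
    qed
    moreover have "(\<Sum>i\<in>UNIV. \<Sum>j\<in>UNIV. (\<Sum>l\<in>UNIV. metric_coeff_deriv S c l i j (y s) * \<eta> s $ l) * \<eta> s $ i * \<eta> s $ j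
         - metric_coeff S c i j (y s) * \<Gamma> $ i * \<eta> s $ j - metric_coeff S c i j (y s) * \<eta> s $ i * \<Gamma> $ j) = 0"
    proof -
      have sym: "metric_coeff S c 2 1 (y s) = metric_coeff S c 1 2 (y s)"
        using metric_coeff_sym[OF cat y] by blast
      have "(\<Sum>i\<in>UNIV. \<Sum>j\<in>UNIV. (\<Sum>l\<in>UNIV. metric_coeff_deriv S c l i j (y s) * \<eta> s $ l) * \<eta> s $ i * \<eta> s $ j
         - metric_coeff S c i j (y s) * \<Gamma> $ i * \<eta> s $ j - metric_coeff S c i j (y s) * \<eta> s $ i * \<Gamma> $ j) =
         (\<Sum>i\<in>UNIV. \<Sum>j\<in>UNIV. (\<Sum>l\<in>UNIV. metric_coeff_deriv S c l i j (y s) * \<eta> s $ l) * \<eta> s $ i * \<eta> s $ j)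
         - 2 * (\<eta> s $ 1 * (metric_coeff S c 1 1 (y s) * \<Gamma> $ 1 + metric_coeff S c 1 2 (y s) * \<Gamma> $ 2)
              + \<eta> s $ 2 * (metric_coeff S c 2 1 (y s) * \<Gamma> $ 1 + metric_coeff S c 2 2 (y s) * \<Gamma> $ 2))"
        using sym by (simp add: sum_2 algebra_simps)
      also have "\<dots> = 0" unfolding con by (simp add: sum_2 symd field_simps)
      finally show ?thesis .
    qed
    ultimately have "((\<lambda>r. coord_norm_sq c (y r, \<eta> r)) has_vector_derivative 0) (at s within J)"
      by (simp add: has_real_derivative_iff_has_vector_derivative)
    then have "(f has_vector_derivative 0) (at s within J)"
    proof (rule has_vector_derivative_transform[OF sJ, rotated])
      fix r assume r: "r \<in> J"
      then have "r \<in> {0..T}" using Jsub by blast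
      then show "f r = coord_norm_sq c (y r, \<eta> r)"
        unfolding f_def y_def \<eta>_def using metric_coord_norm_sq[OF Jc[OF r]] geodesicD(1)[OF g] by blast
    qed
    then show ?thesis by (simp add: Jat)
  qed
  then obtain C where "\<And>s. s \<in> {0..T} \<Longrightarrow> f s = C"
    using has_vector_derivative_zero_constant[of "{0..T}" f] convex_real_interval(5) by blast
  then have "f t = f 0" using t by simp
  then show ?thesis
    using u geodesicD[OF g t] by (auto simp: f_def unit_bundle_def case_prod_beta)
qed

section \<open>Travel time along a geodesic\<close>

lemma closed_boundary_times:
  assumes "geodesic S T \<zeta>"
  shows "closed {t \<in> {0..T}. fst (\<zeta> t) \<in> boundary S}"
proof -
  have "continuous_map (top_of_set {0..T}) (space_of S) (fst \<circ> \<zeta>)"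
    using assms by (auto simp: geodesic_def)
  from closedin_continuous_map_preimage[OF this closedin_boundary]
  have "closedin (top_of_set {0..T}) {t \<in> {0..T}. fst (\<zeta> t) \<in> boundary S}" by simp
  then show ?thesis using closedin_closed_trans closed_atLeastAtMost by blast
qed

text \<open>The part of a geodesic up to its first positive time on the boundary.  It may start on the
  boundary or in the interior, so that a shift in time yields an object of the same kind.\<close>

definition maximal_geodesic :: "real \<Rightarrow> (real \<Rightarrow> 'a \<times> 'a tvec) \<Rightarrow> bool" where
  "maximal_geodesic T \<zeta> \<longleftrightarrow> 0 < T \<and> geodesic S T \<zeta> \<and> fst (\<zeta> T) \<in> boundary S \<and>
     (\<forall>t. 0 < t \<and> t < T \<longrightarrow> fst (\<zeta> t) \<notin> boundary S)"

text \<open>An earlier hitting time would come from a geodesic that agrees with this one by uniqueness.\<close>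

lemma travel_time_maximal:
  assumes "maximal_geodesic T \<zeta>"
  shows "travel_time S (\<zeta> 0) = T"
proof -
  have m: "0 < T" "geodesic S T \<zeta>" "fst (\<zeta> T) \<in> boundary S"
    "\<And>t. 0 < t \<Longrightarrow> t < T \<Longrightarrow> fst (\<zeta> t) \<notin> boundary S"
    using assms by (auto simp: maximal_geodesic_def)
  have T: "T \<in> hitting_times S (\<zeta> 0)" using m by (auto simp: hitting_times_def)
  have "T \<le> t" if "t \<in> hitting_times S (\<zeta> 0)" for t
  proof (rule ccontr)
    assume "\<not> T \<le> t"
    obtain \<zeta>' where \<zeta>': "0 < t" "geodesic S t \<zeta>'" "\<zeta>' 0 = \<zeta> 0" "fst (\<zeta>' t) \<in> boundary S"
      using \<open>t \<in> hitting_times S (\<zeta> 0)\<close> by (auto simp: hitting_times_def)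
    have "\<zeta>' t = \<zeta> t"
      using geodesic_unique[OF \<zeta>'(2) geodesic_restrict[OF m(2)] \<zeta>'(3), of t] \<zeta>'(1) \<open>\<not> T \<le> t\<close> by auto
    then show False using m(4)[of t] \<zeta>' \<open>\<not> T \<le> t\<close> by simp
  qed
  then have "Inf (hitting_times S (\<zeta> 0)) = T" using T by (intro cInf_eq_minimum)
  then show ?thesis using T by (auto simp: travel_time_def)
qed

lemma maximal_geodesic_shift:
  assumes "maximal_geodesic T \<zeta>" "0 \<le> t" "t < T"
  shows "maximal_geodesic (T - t) (\<lambda>s. \<zeta> (t + s))"
  using assms geodesic_shift[of S T \<zeta> t] by (auto simp: maximal_geodesic_def)

lemma travel_time_along_maximal:
  assumes "maximal_geodesic T \<zeta>" "0 \<le> t" "t < T"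
  shows "travel_time S (\<zeta> t) = T - t"
  using travel_time_maximal[OF maximal_geodesic_shift[OF assms]] by simp

text \<open>The infimum of the hitting times is attained: by uniqueness, the hitting times up to some fixed one
  are the positive times at which a single geodesic is on the boundary, and this set of times is closed.\<close>

lemma maximal_geodesic_exists:
  assumes "0 < travel_time S \<xi>"
  obtains \<zeta> where "maximal_geodesic (travel_time S \<xi>) \<zeta>" "\<zeta> 0 = \<xi>"
proof -
  let ?H = "hitting_times S \<xi>" and ?T = "travel_time S \<xi>"
  have ne: "?H \<noteq> {}" and T: "?T = Inf ?H" using assms by (auto simp: travel_time_def split: if_splits)
  have bdd: "bdd_below ?H" by (rule bdd_belowI[of _ 0]) (auto simp: hitting_times_def)
  obtain t0 where "t0 \<in> ?H" using ne by blast
  then obtain \<zeta> where \<zeta>: "0 < t0" "geodesic S t0 \<zeta>" "\<zeta> 0 = \<xi>" "fst (\<zeta> t0) \<in> boundary S"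
    by (auto simp: hitting_times_def)
  have Tt0: "?T \<le> t0" using T cInf_lower[OF \<open>t0 \<in> ?H\<close> bdd] by simp
  define B where "B = {t \<in> {0..t0}. fst (\<zeta> t) \<in> boundary S}"
  have HB: "t \<in> B" if "t \<in> ?H" "t \<le> t0" for t
  proof -
    obtain \<zeta>' where \<zeta>': "0 < t" "geodesic S t \<zeta>'" "\<zeta>' 0 = \<xi>" "fst (\<zeta>' t) \<in> boundary S"
      using \<open>t \<in> ?H\<close> unfolding hitting_times_def by blast
    have "\<zeta>' t = \<zeta> t"
      using geodesic_unique[OF \<zeta>'(2) geodesic_restrict[OF \<zeta>(2)], of t] \<zeta>' \<zeta> that by auto
    then show ?thesis using \<zeta>' that by (simp add: B_def)
  qed
  have BH: "t \<in> ?H" if "t \<in> B" "0 < t" for t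
    using that \<zeta> geodesic_restrict[OF \<zeta>(2), of t] by (auto simp: B_def hitting_times_def)
  have "?T \<in> closure B"
    unfolding closure_approachable
  proof (intro allI impI)
    fix e :: real assume "e > 0"
    then obtain t where t: "t \<in> ?H" "t < ?T + e" using cInf_lessD[OF ne, of "?T + e"] T by auto
    have "?T \<le> min t t0" using cInf_lower[OF t(1) bdd] T Tt0 by simp
    moreover have "min t t0 \<in> B" using HB t \<open>t0 \<in> ?H\<close> by (auto simp: min_def)
    ultimately show "\<exists>y\<in>B. dist y ?T < e"
      using t by (intro bexI[of _ "min t t0"]) (auto simp: dist_real_def)
  qed
  then have TB: "?T \<in> B" using closed_boundary_times[OF \<zeta>(2)] by (simp add: B_def)
  have "maximal_geodesic ?T \<zeta>"
    unfolding maximal_geodesic_def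
  proof (intro conjI allI impI)
    show "geodesic S ?T \<zeta>" using geodesic_restrict[OF \<zeta>(2)] assms Tt0 by simp
    show "fst (\<zeta> ?T) \<in> boundary S" using TB by (simp add: B_def)
    fix t assume t: "0 < t \<and> t < ?T"
    show "fst (\<zeta> t) \<notin> boundary S"
    proof
      assume "fst (\<zeta> t) \<in> boundary S"
      then have "t \<in> B" using t Tt0 by (simp add: B_def)
      then have "?T \<le> t" using BH t cInf_lower[OF _ bdd] T by simp
      then show False using t by simp
    qed
  qed (rule assms)
  then show thesis using \<zeta>(3) that by blast
qed

section \<open>Integration by parts along geodesics\<close>

lemma smooth_fun_along_geodesic:
  assumes a: "smooth_fun S a" and g: "geodesic S T \<zeta>"
  shows "continuous_on {0..T} (\<lambda>t. a (fst (\<zeta> t)))"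
  unfolding continuous_on_eq_continuous_within
proof
  fix t assume t: "t \<in> {0..T}"
  obtain c where c: "c \<in> charts_at S (fst (\<zeta> t))" using charts_at_nonempty geodesicD[OF g t] by blast
  have cat: "c \<in> atlas S" using c charts_at_atlas by blast
  obtain J where J: "t \<in> J" "J \<subseteq> {0..T}" "at t within J = at t within {0..T}"
    "\<And>s. s \<in> J \<Longrightarrow> c \<in> charts_at S (fst (\<zeta> s))"
    using geodesic_chart_nbhd[OF g t c] by metis
  have "smooth_on (cdom c) (a \<circ> cpoint c)" using a cat unfolding smooth_fun_def by blast
  then have "continuous_on (cdom c) (a \<circ> cpoint c)" by (rule smooth_on_imp_continuous_on)
  moreover have "continuous_on J (\<lambda>s. snd c (fst (\<zeta> s)))"
  proof (rule continuous_on_vector_derivative)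
    fix s assume s: "s \<in> J"
    have "((\<lambda>s. snd c (fst (\<zeta> s))) has_vector_derivative snd (\<zeta> s) c) (at s within {0..T})"
      using g J(2,4) s unfolding geodesic_def by blast
    then show "((\<lambda>s. snd c (fst (\<zeta> s))) has_vector_derivative snd (\<zeta> s) c) (at s within J)"
      using J(2) by (rule has_vector_derivative_within_subset)
  qed
  moreover have "(\<lambda>s. snd c (fst (\<zeta> s))) ` J \<subseteq> cdom c"
    using J(4) by (auto intro!: chart_in_cdom charts_at_atlas(2))
  ultimately have "continuous_on J (\<lambda>s. (a \<circ> cpoint c) (snd c (fst (\<zeta> s))))"
    by (rule continuous_on_compose2)
  then have "continuous_on J (\<lambda>s. a (fst (\<zeta> s)))"
    by (rule continuous_on_eq) (simp add: cpoint_chart[OF cat] charts_at_atlas(2)[OF J(4)])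
  then show "continuous (at t within {0..T}) (\<lambda>t. a (fst (\<zeta> t)))"
    using J(1,3) unfolding continuous_on_eq_continuous_within by metis
qed

lemma normalize_differentiable:
  assumes "c \<in> atlas S" "y \<in> cdom c" "\<eta> \<noteq> 0"
  shows "(\<lambda>z. (fst z, snd z /\<^sub>R sqrt (coord_norm_sq c z))) differentiable (at (y, \<eta>) within cdom c \<times> (- {0}))"
proof -
  have "coord_norm_sq c differentiable (at (y, \<eta>) within cdom c \<times> UNIV)"
    using smooth_on_imp_differentiable[OF coord_norm_sq_smooth[OF assms(1)]] assms(2) by simp
  then obtain Q where "(coord_norm_sq c has_derivative Q) (at (y, \<eta>) within cdom c \<times> UNIV)"
    unfolding differentiable_def by blast
  then have Q: "(coord_norm_sq c has_derivative Q) (at (y, \<eta>) within cdom c \<times> (- {0}))"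
    by (rule has_derivative_subset) auto
  have pos: "coord_norm_sq c (y, \<eta>) > 0" by (rule coord_norm_sq_pos[OF assms])
  have "(sqrt has_derivative (\<lambda>h. h * (inverse (sqrt (coord_norm_sq c (y, \<eta>))) / 2))) (at (coord_norm_sq c (y, \<eta>)))"
    by (rule has_derivative_eq_rhs[OF DERIV_real_sqrt[OF pos, unfolded has_field_derivative_def]])
      (simp add: fun_eq_iff)
  from has_derivative_compose[OF Q this]
  have "((\<lambda>z. sqrt (coord_norm_sq c z)) has_derivative (\<lambda>h. Q h * (inverse (sqrt (coord_norm_sq c (y, \<eta>))) / 2))) (at (y, \<eta>) within cdom c \<times> (- {0}))" .
  from Deriv.has_derivative_inverse[OF _ this] pos
  have "((\<lambda>z. inverse (sqrt (coord_norm_sq c z))) has_derivative (\<lambda>h. - (inverse (sqrt (coord_norm_sq c (y, \<eta>))) * (Q h * (inverse (sqrt (coord_norm_sq c (y, \<eta>))) / 2)) * inverse (sqrt (coord_norm_sq c (y, \<eta>)))))) (at (y, \<eta>) within cdom c \<times> (- {0}))"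
    by simp
  from has_derivative_Pair[OF has_derivative_fst[OF has_derivative_ident]
      has_derivative_scaleR[OF this has_derivative_snd[OF has_derivative_ident]]]
  show ?thesis unfolding differentiable_def by blast
qed

text \<open>Smoothness of \<open>F\<close> only controls it on the unit bundle.  In coordinates the homogeneous extension is
  the composition with the differentiable map dividing by the length, which sends nonzero
  vectors to the unit bundle.\<close>

lemma homogeneous_extension_differentiable:
  assumes F: "smooth_bundle_fun S F" and xv: "(x, v) \<in> unit_bundle S" and c: "c \<in> charts_at S x"
  shows "(F \<circ> normalize_tvec S \<circ> bundle_point S c) differentiable
    (at (snd c x, v c) within cdom c \<times> (- {0}))"
proof -
  define D where "D = {(y, \<eta>). y \<in> cdom c \<and> bundle_point S c (y, \<eta>) \<in> unit_bundle S}"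
  define N where "N = (\<lambda>z :: (real^2) \<times> (real^2). (fst z, snd z /\<^sub>R sqrt (coord_norm_sq c z)))"
  define z0 where "z0 = (snd c x, v c)"
  have cat: "c \<in> atlas S" "x \<in> fst c" using c charts_at_atlas by blast+
  have v: "v \<in> tangent_space S x" "metric S x v v = 1" using xv by (auto simp: unit_bundle_def)
  have y: "snd c x \<in> cdom c" by (rule chart_in_cdom[OF cat(2)])
  have \<eta>: "v c \<noteq> 0" by (rule unit_bundle_nonzero[OF xv c])
  have Nz0: "N z0 = z0" using metric_coord_norm_sq[OF c v(1)] v(2) by (simp add: N_def z0_def)
  have z0D: "z0 \<in> D" using y bundle_point_coords[OF c v(1)] xv by (simp add: D_def z0_def)
  have ND: "N ` (cdom c \<times> (- {0})) \<subseteq> D"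
    using normalize_bundle_point(2)[OF cat(1)] by (auto simp: N_def D_def)
  obtain N' where N': "(N has_derivative N') (at z0 within cdom c \<times> (- {0}))"
    using normalize_differentiable[OF cat(1) y \<eta>] unfolding differentiable_def N_def z0_def by blast
  have "smooth_on D (F \<circ> bundle_point S c)"
    using F cat(1) unfolding smooth_bundle_fun_def D_def by blast
  from smooth_on_imp_differentiable[OF this z0D]
  obtain G' where "((F \<circ> bundle_point S c) has_derivative G') (at z0 within D)"
    unfolding differentiable_def by blast
  from has_derivative_subset[OF this ND]
  have "((F \<circ> bundle_point S c) has_derivative G') (at (N z0) within N ` (cdom c \<times> (- {0})))"
    by (simp add: Nz0)
  from diff_chain_within[OF N' this]
  have "((F \<circ> normalize_tvec S \<circ> bundle_point S c) has_derivative G' \<circ> N') (at z0 within cdom c \<times> (- {0}))"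
  proof (rule has_derivative_transform[rotated 2])
    fix z assume "z \<in> cdom c \<times> (- {0 :: real^2})"
    then obtain y \<eta> where "z = (y, \<eta>)" "y \<in> cdom c" "\<eta> \<noteq> 0" by auto
    then show "(F \<circ> normalize_tvec S \<circ> bundle_point S c) z = (F \<circ> bundle_point S c \<circ> N) z"
      using normalize_bundle_point(1)[OF cat(1)] by (simp add: N_def)
  qed (use y \<eta> in \<open>simp add: z0_def\<close>)
  then show ?thesis unfolding differentiable_def z0_def by blast
qed

text \<open>The chain rule: in coordinates the velocity of the curve is the vector at which
  \<open>geodesic_generator\<close> evaluates the derivative, and the homogeneous extension of \<open>F\<close> equals \<open>F\<close> along
  a curve of unit vectors.  At the ends of the interval the derivative is one-sided.\<close>

lemma has_vector_derivative_along_geodesic: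
  assumes F: "smooth_bundle_fun S F" and g: "geodesic S T \<zeta>"
    and u: "\<zeta> 0 \<in> unit_bundle S" and t: "t \<in> {0..T}"
  shows "((\<lambda>s. F (\<zeta> s)) has_vector_derivative geodesic_generator S F (\<zeta> t)) (at t within {0..T})"
proof -
  define x v where "x = fst (\<zeta> t)" and "v = snd (\<zeta> t)"
  have xv: "\<zeta> t = (x, v)" by (simp add: x_def v_def)
  have unit: "\<zeta> s \<in> unit_bundle S" if "s \<in> {0..T}" for s
    using geodesic_unit_speed[OF g u that] .
  have x: "x \<in> points S" using geodesicD[OF g t] by (simp add: x_def)
  define c where "c = chart_at S x"
  have c: "c \<in> charts_at S x" using chart_at_charts_at[OF x] by (simp add: c_def)
  define H where "H = F \<circ> normalize_tvec S \<circ> bundle_point S c"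
  define W where "W = cdom c \<times> (- {0 :: real^2})"
  define DH where "DH = frechet_derivative H (at (snd c x, v c) within W)"
  have DH: "(H has_derivative DH) (at (coords c (\<zeta> t)) within W)"
    using homogeneous_extension_differentiable[OF F unit[OF t, unfolded xv] c]
    by (simp add: H_def W_def DH_def frechet_derivative_works coords_def xv)
  obtain J where J: "t \<in> J" "J \<subseteq> {0..T}" "at t within J = at t within {0..T}"
    "\<And>s. s \<in> J \<Longrightarrow> c \<in> charts_at S (fst (\<zeta> s))"
    using geodesic_chart_nbhd[OF g t] c x_def by metis
  have "((\<lambda>s. coords c (\<zeta> s)) has_vector_derivative geodesic_field c (coords c (\<zeta> t))) (at t within J)"
    using geodesic_coords_derivative[OF g t J(4)[OF J(1)]] J(3) by simp
  then have 1: "((\<lambda>s. coords c (\<zeta> s)) has_derivative (\<lambda>h. h *\<^sub>R geodesic_field c (coords c (\<zeta> t)))) (at t within J)"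
    by (simp add: has_vector_derivative_def)
  have im: "(\<lambda>s. coords c (\<zeta> s)) ` J \<subseteq> W"
  proof (rule image_subsetI)
    fix s assume s: "s \<in> J"
    have "snd (\<zeta> s) c \<noteq> 0"
      using unit_bundle_nonzero[OF _ J(4)[OF s], of "snd (\<zeta> s)"] unit s J(2) by auto
    then show "coords c (\<zeta> s) \<in> W"
      using chart_in_cdom[OF charts_at_atlas(2)[OF J(4)[OF s]]]
      by (simp add: W_def coords_def case_prod_beta)
  qed
  have "((H \<circ> (\<lambda>s. coords c (\<zeta> s))) has_derivative DH \<circ> (\<lambda>h. h *\<^sub>R geodesic_field c (coords c (\<zeta> t)))) (at t within J)"
    by (rule diff_chain_within[OF 1 has_derivative_subset[OF DH im]])
  moreover have "DH \<circ> (\<lambda>h. h *\<^sub>R geodesic_field c (coords c (\<zeta> t))) = (\<lambda>h. h *\<^sub>R DH (geodesic_field c (coords c (\<zeta> t))))"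
    using has_derivative_linear[OF DH] by (auto simp: linear_scale)
  ultimately have "((H \<circ> (\<lambda>s. coords c (\<zeta> s))) has_vector_derivative DH (geodesic_field c (coords c (\<zeta> t)))) (at t within J)"
    by (simp add: has_vector_derivative_def)
  then have "((\<lambda>s. F (\<zeta> s)) has_vector_derivative DH (geodesic_field c (coords c (\<zeta> t)))) (at t within J)"
  proof (rule has_vector_derivative_transform[OF J(1), rotated])
    fix s assume s: "s \<in> J"
    have us: "(fst (\<zeta> s), snd (\<zeta> s)) \<in> unit_bundle S" using unit s J(2) by auto
    then have "bundle_point S c (coords c (\<zeta> s)) = \<zeta> s"
      using bundle_point_coords[OF J(4)[OF s], of "snd (\<zeta> s)"]
      by (simp add: coords_def case_prod_beta unit_bundle_def)
    moreover have "normalize_tvec S (\<zeta> s) = \<zeta> s"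
      using us by (simp add: normalize_tvec_def unit_bundle_def case_prod_beta)
    ultimately show "F (\<zeta> s) = (H \<circ> (\<lambda>s. coords c (\<zeta> s))) s" by (simp add: H_def)
  qed
  moreover have "geodesic_generator S F (\<zeta> t) = DH (geodesic_field c (coords c (\<zeta> t)))"
    by (simp add: geodesic_generator_def xv Let_def DH_def H_def W_def coords_def geodesic_field_def flip: c_def)
  ultimately show ?thesis by (simp add: J(3))
qed

text \<open>The values of \<open>p\<close> on the unit bundle determine its homogeneous extension, and derivatives within
  the coordinate domain are unique.\<close>

lemma generator_vanishes:
  assumes p: "\<And>\<xi>. \<xi> \<in> unit_bundle S \<Longrightarrow> p \<xi> = 0" and \<xi>: "\<xi> \<in> unit_bundle S"
  shows "geodesic_generator S p \<xi> = 0"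
proof -
  obtain x v where xv: "\<xi> = (x, v)" by force
  have v: "x \<in> points S" "v \<in> tangent_space S x" using \<xi> by (auto simp: xv unit_bundle_def)
  define c where "c = chart_at S x"
  have c: "c \<in> charts_at S x" using chart_at_charts_at[OF v(1)] by (simp add: c_def)
  have cat: "c \<in> atlas S" "x \<in> fst c" using c charts_at_atlas by blast+
  have y: "snd c x \<in> cdom c" by (rule chart_in_cdom[OF cat(2)])
  have \<eta>: "v c \<noteq> 0" using unit_bundle_nonzero[OF _ c] \<xi> xv by blast
  have "((p \<circ> normalize_tvec S \<circ> bundle_point S c) has_derivative (\<lambda>h. 0)) (at (snd c x, v c) within cdom c \<times> (- {0}))"
  proof (rule has_derivative_transform[OF _ _ has_derivative_const])
    fix z assume "z \<in> cdom c \<times> (- {0 :: real^2})"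
    then obtain y \<eta> where "z = (y, \<eta>)" "y \<in> cdom c" "\<eta> \<noteq> 0" by auto
    then show "(p \<circ> normalize_tvec S \<circ> bundle_point S c) z = 0"
      using p normalize_bundle_point[OF cat(1)] by simp
  qed (use y \<eta> in simp)
  then have "frechet_derivative (p \<circ> normalize_tvec S \<circ> bundle_point S c)
      (at (snd c x, v c) within cdom c \<times> (- {0})) = (\<lambda>h. 0)"
    by (rule frechet_derivative_half_plane_Times[OF cdom_openin[OF cat(1)] y \<eta>])
  then show ?thesis
    by (simp add: geodesic_generator_def xv Let_def flip: c_def)
qed

lemma weight_along_maximal:
  assumes m: "maximal_geodesic T \<zeta>" and t: "0 \<le> t" "t < T"
  shows "weight S a (\<zeta> t) = exp (- integral {t..T} (\<lambda>s. a (fst (\<zeta> s))))"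
proof -
  have g: "geodesic S T \<zeta>" using m by (simp add: maximal_geodesic_def)
  have "integral {0..T - t} (\<lambda>s. a (fst (geodesic_flow S s (\<zeta> t))))
      = integral {0..T - t} (\<lambda>s. a (fst (\<zeta> (s + t))))"
    by (rule integral_cong) (use geodesic_flow_shift[OF g t(1)] in \<open>simp add: add.commute\<close>)
  also have "\<dots> = integral {t..T} (\<lambda>s. a (fst (\<zeta> s)))"
    using integral_shift_real_ivl[of t t T "\<lambda>s. a (fst (\<zeta> s))"] by simp
  finally show ?thesis by (simp add: weight_def travel_time_along_maximal[OF m t])
qed

text \<open>The point \<open>t = T\<close> is discarded as a null set: there the travel time refers to a possible continuation
  beyond the boundary point.\<close>

lemma ray_transform_along_maximal:
  assumes m: "maximal_geodesic T \<zeta>"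
  shows "ray_transform S a (\<lambda>\<xi>. complex_of_real (travel_time S \<xi>) ^ k * F \<xi>) (\<zeta> 0) =
    integral {0..T} (\<lambda>t. exp (- integral {t..T} (\<lambda>s. a (fst (\<zeta> s)))) * (complex_of_real (T - t) ^ k * F (\<zeta> t)))"
proof -
  have g: "geodesic S T \<zeta>" using m by (simp add: maximal_geodesic_def)
  show ?thesis
    unfolding ray_transform_def travel_time_maximal[OF m]
  proof (rule integral_spike[of "{T}"])
    fix t assume "t \<in> {0..T} - {T}"
    then have t: "0 \<le> t" "t < T" by auto
    then show "exp (- integral {t..T} (\<lambda>s. a (fst (\<zeta> s)))) * (complex_of_real (T - t) ^ k * F (\<zeta> t)) =
      weight S a (geodesic_flow S t (\<zeta> 0)) * (complex_of_real (travel_time S (geodesic_flow S t (\<zeta> 0))) ^ k *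
             F (geodesic_flow S t (\<zeta> 0)))"
      using geodesic_flow_eq[OF g t(1)] weight_along_maximal[OF m t] travel_time_along_maximal[OF m t] by simp
  qed simp
qed

lemma weight_derivative:
  assumes "smooth_fun S a" "geodesic S T \<zeta>" "t \<in> {0..T}"
  shows "((\<lambda>t. exp (- integral {t..T} (\<lambda>s. a (fst (\<zeta> s))))) has_vector_derivative
     a (fst (\<zeta> t)) * exp (- integral {t..T} (\<lambda>s. a (fst (\<zeta> s))))) (at t within {0..T})"
proof -
  have "((\<lambda>t. integral {t..T} (\<lambda>s. a (fst (\<zeta> s)))) has_vector_derivative - a (fst (\<zeta> t))) (at t within {0..T})"
    by (rule integral_has_vector_derivative'[OF smooth_fun_along_geodesic[OF assms(1,2)] assms(3)])
  from has_vector_derivative_minus[OF this]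
  have "((\<lambda>t. - integral {t..T} (\<lambda>s. a (fst (\<zeta> s)))) has_vector_derivative a (fst (\<zeta> t))) (at t within {0..T})" by simp
  from field_vector_diff_chain_within[OF this has_field_derivative_at_within[OF DERIV_exp]]
  show ?thesis by (simp add: o_def)
qed

lemma ray_integrand_integrable:
  assumes a: "smooth_fun S a" and F: "smooth_bundle_fun S F"
    and g: "geodesic S T \<zeta>" and u: "\<zeta> 0 \<in> unit_bundle S"
  shows "(\<lambda>t. exp (- integral {t..T} (\<lambda>s. a (fst (\<zeta> s)))) * (complex_of_real (T - t) ^ k * F (\<zeta> t)))
    integrable_on {0..T}"
proof (intro integrable_continuous_real continuous_on_mult)
  show "continuous_on {0..T} (\<lambda>t. exp (- integral {t..T} (\<lambda>s. a (fst (\<zeta> s)))))"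
    by (rule continuous_on_vector_derivative) (rule weight_derivative[OF a g])
  show "continuous_on {0..T} (\<lambda>t. F (\<zeta> t))"
    by (rule continuous_on_vector_derivative) (rule has_vector_derivative_along_geodesic[OF F g u])
  show "continuous_on {0..T} (\<lambda>t. complex_of_real (T - t) ^ k)"
    by (intro continuous_intros)
qed

lemma boundary_bundle_unit: "\<xi> \<in> boundary_bundle S \<Longrightarrow> \<xi> \<in> unit_bundle S"
  by (auto simp: boundary_bundle_def)

lemma travel_time_nonneg: "0 \<le> travel_time S \<xi>"
proof -
  have "hitting_times S \<xi> \<noteq> {} \<Longrightarrow> 0 \<le> Inf (hitting_times S \<xi>)"
    by (rule cInf_greatest) (auto simp: hitting_times_def)
  then show ?thesis by (simp add: travel_time_def)
qed

text \<open>The derivative of \<open>w (T - t)\<^sup>k\<^sup>+\<^sup>1 p\<close> along a geodesic of length \<open>T\<close> is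
  \<open>w (T - t)\<^sup>k\<^sup>+\<^sup>1 (X + a) p - (k + 1) w (T - t)\<^sup>k p\<close>, because \<open>w' = a w\<close>, and the function vanishes at both
  ends together with \<open>p\<close>.\<close>

lemma moment_integration_by_parts:
  assumes a: "smooth_fun S a" and p: "smooth_bundle_fun S p"
    and p0: "\<And>\<xi>. \<xi> \<in> boundary_bundle S \<Longrightarrow> p \<xi> = 0"
    and F: "\<And>\<xi>. \<xi> \<in> unit_bundle S \<Longrightarrow> F \<xi> = geodesic_generator S p \<xi> + a (fst \<xi>) * p \<xi>"
    and \<xi>: "\<xi> \<in> boundary_bundle S"
  shows "ray_transform S a (\<lambda>\<xi>. complex_of_real (travel_time S \<xi>) ^ Suc k * F \<xi>) \<xi> =
    of_nat (Suc k) * ray_transform S a (\<lambda>\<xi>. complex_of_real (travel_time S \<xi>) ^ k * p \<xi>) \<xi>"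
proof (cases "0 < travel_time S \<xi>")
  case False
  then have "travel_time S \<xi> = 0" using travel_time_nonneg[of \<xi>] by simp
  then show ?thesis by (simp add: ray_transform_def)
next
  case True
  define T where "T = travel_time S \<xi>"
  obtain \<zeta> where m: "maximal_geodesic T \<zeta>" and \<zeta>0: "\<zeta> 0 = \<xi>"
    using maximal_geodesic_exists[OF True] by (auto simp: T_def)
  have g: "geodesic S T \<zeta>" and T: "0 < T" using m by (auto simp: maximal_geodesic_def)
  have u: "\<zeta> 0 \<in> unit_bundle S" using \<xi> \<zeta>0 boundary_bundle_unit by simp
  have unit: "\<zeta> s \<in> unit_bundle S" if "s \<in> {0..T}" for s
    using geodesic_unit_speed[OF g u that] .
  have "\<zeta> T \<in> boundary_bundle S"
    using unit[of T] m T by (auto simp: boundary_bundle_def maximal_geodesic_def case_prod_beta)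
  then have ends: "p (\<zeta> 0) = 0" "p (\<zeta> T) = 0" using p0 \<xi> \<zeta>0 by auto
  define w where "w t = exp (- integral {t..T} (\<lambda>s. a (fst (\<zeta> s))))" for t
  define A where "A t = w t * (complex_of_real (T - t) ^ Suc k * F (\<zeta> t))" for t
  define B where "B t = w t * (complex_of_real (T - t) ^ k * p (\<zeta> t))" for t
  have der: "((\<lambda>t. w t * (complex_of_real (T - t) ^ Suc k * p (\<zeta> t))) has_vector_derivative
      A t - of_nat (Suc k) * B t) (at t within {0..T})" if t: "t \<in> {0..T}" for t
  proof -
    have 1: "(w has_vector_derivative a (fst (\<zeta> t)) * w t) (at t within {0..T})"
      unfolding w_def[abs_def] by (rule weight_derivative[OF a g t])
    have 2: "((\<lambda>t. p (\<zeta> t)) has_vector_derivative geodesic_generator S p (\<zeta> t)) (at t within {0..T})"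
      by (rule has_vector_derivative_along_geodesic[OF p g u t])
    have "((\<lambda>t. (T - t) ^ Suc k) has_real_derivative - (real (Suc k) * (T - t) ^ k)) (at t within {0..T})"
      by (rule DERIV_cong[OF DERIV_power[OF DERIV_diff[OF DERIV_const DERIV_ident]]]) simp
    from has_vector_derivative_of_real[OF this]
    have 3: "((\<lambda>t. complex_of_real (T - t) ^ Suc k) has_vector_derivative
        - (of_nat (Suc k) * complex_of_real (T - t) ^ k)) (at t within {0..T})"
      by simp
    show ?thesis
      by (rule has_vector_derivative_eq_rhs[OF has_vector_derivative_mult[OF 1 has_vector_derivative_mult[OF 3 2]]])
       (simp add: A_def B_def F[OF unit[OF t]] algebra_simps)
  qed
  have "((\<lambda>t. A t - of_nat (Suc k) * B t) has_integral
      w T * (complex_of_real (T - T) ^ Suc k * p (\<zeta> T)) - w 0 * (complex_of_real (T - 0) ^ Suc k * p (\<zeta> 0))) {0..T}"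
    by (rule fundamental_theorem_of_calculus[OF _ der]) (use T in auto)
  then have 0: "((\<lambda>t. A t - of_nat (Suc k) * B t) has_integral 0) {0..T}" by (simp add: ends)
  have "B integrable_on {0..T}"
    unfolding B_def[abs_def] w_def by (rule ray_integrand_integrable[OF a p g u])
  then have "((\<lambda>t. of_nat (Suc k) * B t) has_integral of_nat (Suc k) * integral {0..T} B) {0..T}"
    by (intro has_integral_mult_right integrable_integral)
  from has_integral_add[OF 0 this] have "(A has_integral of_nat (Suc k) * integral {0..T} B) {0..T}" by simp
  then have "integral {0..T} A = of_nat (Suc k) * integral {0..T} B" by (rule integral_unique)
  then show ?thesis
    unfolding \<zeta>0[symmetric] ray_transform_along_maximal[OF m] A_def[abs_def] B_def[abs_def] w_def .
qed

text \<open>The Fourier sum is empty; a frame is needed since the degree is a condition on circles.\<close>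

lemma degree_minus_one_vanishes:
  assumes "degree_on_fibers S (- 1) p" "\<xi> \<in> unit_bundle S"
  shows "p \<xi> = 0"
proof -
  obtain x v where xv: "\<xi> = (x, v)" by force
  obtain w where w: "orthonormal_frame S x v w" using exists_orthonormal_frame assms(2) xv by blast
  have "x \<in> points S" using assms(2) by (auto simp: xv unit_bundle_def)
  then have "p (x, tcomb (cos \<theta>) v (sin \<theta>) w) = (\<Sum>j\<in>{- (- 1)..- 1}. fiber_coeff p x v w j * cis (of_int j * \<theta>))" for \<theta>
    using assms(1) w unfolding degree_on_fibers_def by blast
  from this[of 0] show ?thesis by (simp add: tcomb_def xv)
qed

text \<open>The heart of the proof: each step trades one degree for one moment.\<close>

theorem vanishing_moments:
  assumes a: "smooth_fun S a" and inj: "\<And>k. k \<le> m \<Longrightarrow> s_injective S a k"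
  shows "k \<le> m \<Longrightarrow> degree_on_fibers S (int k) F \<Longrightarrow>
    (\<And>j \<xi>. j \<le> k \<Longrightarrow> \<xi> \<in> influx_bundle S \<Longrightarrow>
       ray_transform S a (\<lambda>\<xi>. complex_of_real (travel_time S \<xi>) ^ j * F \<xi>) \<xi> = 0) \<Longrightarrow>
    \<xi> \<in> unit_bundle S \<Longrightarrow> F \<xi> = 0"
proof (induction k arbitrary: F \<xi>)
  case (0 F \<xi>)
  obtain p where p: "degree_on_fibers S (- 1) p"
    "\<And>\<xi>. \<xi> \<in> unit_bundle S \<Longrightarrow> F \<xi> = geodesic_generator S p \<xi> + a (fst \<xi>) * p \<xi>"
    using inj[OF 0(1)] 0(2) 0(3)[of 0] unfolding s_injective_def by auto
  have "p \<xi> = 0" if "\<xi> \<in> unit_bundle S" for \<xi> using degree_minus_one_vanishes[OF p(1) that] .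
  then show ?case using p(2)[OF 0(4)] generator_vanishes[of p] 0(4) by simp
next
  case (Suc k F \<xi>)
  have "ray_transform S a F \<xi> = 0" if "\<xi> \<in> influx_bundle S" for \<xi>
    using Suc.prems(3)[of 0 \<xi>] that by simp
  then obtain p where p: "degree_on_fibers S (int k) p" "\<And>\<xi>. \<xi> \<in> boundary_bundle S \<Longrightarrow> p \<xi> = 0"
    "\<And>\<xi>. \<xi> \<in> unit_bundle S \<Longrightarrow> F \<xi> = geodesic_generator S p \<xi> + a (fst \<xi>) * p \<xi>"
    using inj[OF Suc.prems(1)] Suc.prems(2) unfolding s_injective_def by auto
  have sp: "smooth_bundle_fun S p" using p(1) unfolding degree_on_fibers_def by blast
  have "p \<xi> = 0" if \<xi>: "\<xi> \<in> unit_bundle S" for \<xi>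
  proof (rule Suc.IH[OF _ p(1) _ \<xi>])
    show "k \<le> m" using Suc.prems(1) by simp
    fix j \<xi> assume j: "j \<le> k" and \<xi>: "\<xi> \<in> influx_bundle S"
    have b: "\<xi> \<in> boundary_bundle S" using \<xi> unfolding influx_bundle_def by blast
    have "ray_transform S a (\<lambda>\<xi>. complex_of_real (travel_time S \<xi>) ^ Suc j * F \<xi>) \<xi> = 0"
      using Suc.prems(3)[of "Suc j" \<xi>] j \<xi> by blast
    with moment_integration_by_parts[OF a sp p(2,3) b]
    have "of_nat (Suc j) * ray_transform S a (\<lambda>\<xi>. complex_of_real (travel_time S \<xi>) ^ j * p \<xi>) \<xi> = 0"
      by (rule trans[OF sym])
    then show "ray_transform S a (\<lambda>\<xi>. complex_of_real (travel_time S \<xi>) ^ j * p \<xi>) \<xi> = 0"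
      using of_nat_neq_0 mult_eq_0_iff by blast
  qed
  then show ?case using p(3)[OF Suc.prems(4)] generator_vanishes[of p] Suc.prems(4) by simp
qed

end

section \<open>Trigonometric polynomials and Fourier coefficients\<close>

text \<open>A trigonometric polynomial of degree at most \<open>m\<close> is an ordinary polynomial in \<open>cis \<theta>\<close> after
  multiplication by \<open>cis (m \<theta>)\<close>.  In this form products reduce to products of polynomials.\<close>

definition trig_poly :: "nat \<Rightarrow> (real \<Rightarrow> complex) \<Rightarrow> bool" where
  "trig_poly m h \<longleftrightarrow> (\<exists>q. degree q \<le> 2 * m \<and> (\<forall>\<theta>. h \<theta> * cis \<theta> ^ m = poly q (cis \<theta>)))"

lemma trig_poly_cos_sin:
  assumes "k \<le> m"
  shows "trig_poly m (\<lambda>\<theta>. complex_of_real (cos \<theta>) ^ k * complex_of_real (sin \<theta>) ^ (m - k))"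
proof -
  \<comment> \<open>\<open>cos \<theta> = (cis \<theta> + cis (- \<theta>)) / 2\<close> and \<open>sin \<theta> = \<i> (cis (- \<theta>) - cis \<theta>) / 2\<close>, times \<open>cis \<theta>\<close>\<close>
  define A :: "complex poly" where "A = [:1/2, 0, 1/2:]"
  define B :: "complex poly" where "B = [:\<i>/2, 0, - \<i>/2:]"
  have A: "complex_of_real (cos \<theta>) * cis \<theta> = poly A (cis \<theta>)" for \<theta>
    using sin_cos_squared_add[of \<theta>]
    by (auto simp: A_def complex_eq_iff power2_eq_square field_simps)
  have B: "complex_of_real (sin \<theta>) * cis \<theta> = poly B (cis \<theta>)" for \<theta>
    using sin_cos_squared_add[of \<theta>]
    by (auto simp: B_def complex_eq_iff power2_eq_square field_simps)
  have "degree (A ^ k * B ^ (m - k)) \<le> 2 * m"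
  proof -
    have "degree (A ^ k * B ^ (m - k)) \<le> degree (A ^ k) + degree (B ^ (m - k))" by (rule degree_mult_le)
    also have "\<dots> \<le> degree A * k + degree B * (m - k)" by (intro add_mono degree_power_le)
    also have "\<dots> = 2 * m" using assms by (simp add: A_def B_def)
    finally show ?thesis .
  qed
  moreover have "complex_of_real (cos \<theta>) ^ k * complex_of_real (sin \<theta>) ^ (m - k) * cis \<theta> ^ m
      = poly (A ^ k * B ^ (m - k)) (cis \<theta>)" for \<theta>
  proof -
    have "cis \<theta> ^ m = cis \<theta> ^ k * cis \<theta> ^ (m - k)" using assms by (simp flip: power_add)
    then show ?thesis by (simp flip: A B) (simp add: power_mult_distrib)
  qed
  ultimately show ?thesis unfolding trig_poly_def by blast
qed

lemma trig_poly_cmult: "trig_poly m h \<Longrightarrow> trig_poly m (\<lambda>\<theta>. c * h \<theta>)"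
  unfolding trig_poly_def
  by (elim exE conjE, rule_tac x = "Polynomial.smult c q" in exI)
    (auto intro: order_trans[OF degree_smult_le] simp: mult.assoc)

lemma trig_poly_add: "trig_poly m h \<Longrightarrow> trig_poly m h' \<Longrightarrow> trig_poly m (\<lambda>\<theta>. h \<theta> + h' \<theta>)"
  unfolding trig_poly_def
  by (elim exE conjE, rule_tac x = "q + qa" in exI) (auto intro: degree_add_le simp: algebra_simps)

lemma trig_poly_zero: "trig_poly m (\<lambda>\<theta>. 0)"
  unfolding trig_poly_def by (rule exI[of _ 0]) simp

lemma trig_poly_sum:
  "finite I \<Longrightarrow> (\<And>i. i \<in> I \<Longrightarrow> trig_poly m (h i)) \<Longrightarrow> trig_poly m (\<lambda>\<theta>. \<Sum>i\<in>I. h i \<theta>)"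
  by (induction I rule: finite_induct) (auto intro: trig_poly_zero trig_poly_add)

lemma trig_poly_expansion:
  assumes "trig_poly m h"
  obtains c where "\<And>\<theta>. h \<theta> = (\<Sum>j\<in>{- int m..int m}. c j * cis (of_int j * \<theta>))"
proof -
  obtain q where q: "degree q \<le> 2 * m" "\<And>\<theta>. h \<theta> * cis \<theta> ^ m = poly q (cis \<theta>)"
    using assms unfolding trig_poly_def by blast
  have poly: "poly q z = (\<Sum>i\<le>2 * m. coeff q i * z ^ i)" for z
    unfolding poly_altdef
    by (rule sum.mono_neutral_left) (use q(1) in \<open>auto simp: coeff_eq_0\<close>)
  show thesis
  proof (rule that)
    fix \<theta> :: real
    have "h \<theta> = h \<theta> * cis \<theta> ^ m * cis (- (real m * \<theta>))"
      by (simp add: Complex.DeMoivre cis_mult mult.assoc)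
    also have "\<dots> = (\<Sum>i\<le>2 * m. coeff q i * cis \<theta> ^ i) * cis (- (real m * \<theta>))"
      by (simp add: q(2) poly)
    also have "\<dots> = (\<Sum>i\<le>2 * m. coeff q i * cis (of_int (int i - int m) * \<theta>))"
      unfolding sum_distrib_right
      by (intro sum.cong refl) (simp add: mult.assoc Complex.DeMoivre cis_mult left_diff_distrib)
    also have "\<dots> = (\<Sum>j\<in>{- int m..int m}. coeff q (nat (j + int m)) * cis (of_int j * \<theta>))"
      by (rule sum.reindex_bij_witness[of _ "\<lambda>j. nat (j + int m)" "\<lambda>i. int i - int m"]) auto
    finally show "h \<theta> = (\<Sum>j\<in>{- int m..int m}. coeff q (nat (j + int m)) * cis (of_int j * \<theta>))" .
  qed
qed

lemma integral_cis:
  "((\<lambda>\<theta>. cis (of_int n * \<theta>)) has_integral (if n = 0 then complex_of_real (2 * pi) else 0)) {0..2 * pi}"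
proof (cases "n = 0")
  case True
  then show ?thesis using has_integral_const_real[of "1 :: complex" 0 "2 * pi"]
    by (simp add: scaleR_conv_of_real)
next
  case False
  define E where "E = (\<lambda>z. exp (\<i> * of_int n * z) / (\<i> * of_int n))"
  have cis: "cis (of_int n * \<theta>) = exp (\<i> * of_int n * complex_of_real \<theta>)" for \<theta>
    by (simp add: cis_conv_exp mult.assoc)
  have "(E has_field_derivative exp (\<i> * of_int n * z)) (at z)" for z
    unfolding E_def using False by (auto intro!: derivative_eq_intros)
  then have "((\<lambda>\<theta>. E (complex_of_real \<theta>)) has_vector_derivative cis (of_int n * \<theta>)) (at \<theta> within {0..2 * pi})" for \<theta>
    unfolding cis using has_vector_derivative_real_field by blast
  then have "((\<lambda>\<theta>. cis (of_int n * \<theta>)) has_integral E (of_real (2 * pi)) - E (of_real 0)) {0..2 * pi}"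
    by (intro fundamental_theorem_of_calculus) auto
  moreover have "exp (\<i> * of_int n * complex_of_real (2 * pi)) = 1"
    using exp_integer_2pi[of "of_int n"] by (simp add: mult_ac)
  ultimately show ?thesis using False by (simp add: E_def)
qed

lemma fourier_coefficient:
  assumes "\<And>\<theta>. h \<theta> = (\<Sum>j\<in>{- int m..int m}. c j * cis (of_int j * \<theta>))" "l \<in> {- int m..int m}"
  shows "integral {0..2 * pi} (\<lambda>\<theta>. h \<theta> * cis (- (of_int l * \<theta>))) = complex_of_real (2 * pi) * c l"
proof (rule integral_unique)
  have e: "h \<theta> * cis (- (of_int l * \<theta>)) = (\<Sum>j\<in>{- int m..int m}. c j * cis (of_int (j - l) * \<theta>))" for \<theta>
    unfolding assms(1) sum_distrib_right
    by (intro sum.cong refl) (simp add: mult.assoc cis_mult left_diff_distrib)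
  have "((\<lambda>\<theta>. h \<theta> * cis (- (of_int l * \<theta>))) has_integral
      (\<Sum>j\<in>{- int m..int m}. c j * (if j - l = 0 then complex_of_real (2 * pi) else 0))) {0..2 * pi}"
    unfolding e by (intro has_integral_sum has_integral_mult_right integral_cis) auto
  also have "(\<Sum>j\<in>{- int m..int m}. c j * (if j - l = 0 then complex_of_real (2 * pi) else 0))
      = complex_of_real (2 * pi) * c l"
    using assms(2) by (simp add: if_distrib[of "\<lambda>x. _ * x"] mult.commute cong: if_cong)
  finally show "((\<lambda>\<theta>. h \<theta> * cis (- (of_int l * \<theta>))) has_integral complex_of_real (2 * pi) * c l) {0..2 * pi}" .
qed

section \<open>Symmetric multilinear forms\<close>

locale symmetric_form =
  fixes V :: "'a tvec set" and m :: nat and g :: "'a tvec list \<Rightarrow> complex"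
  assumes comb: "\<And>v w r s. v \<in> V \<Longrightarrow> w \<in> V \<Longrightarrow> tcomb r v s w \<in> V"
    and linear: "\<And>vs i v w r s. length vs = m \<Longrightarrow> set vs \<subseteq> V \<Longrightarrow> i < m \<Longrightarrow> v \<in> V \<Longrightarrow> w \<in> V \<Longrightarrow>
      g (vs[i := tcomb r v s w]) = complex_of_real r * g (vs[i := v]) + complex_of_real s * g (vs[i := w])"
    and perm: "\<And>vs ws. length vs = m \<Longrightarrow> set vs \<subseteq> V \<Longrightarrow> mset ws = mset vs \<Longrightarrow> g ws = g vs"
begin

lemma linear_middle:
  assumes "length us + Suc (length zs) = m" "set us \<subseteq> V" "set zs \<subseteq> V" "v \<in> V" "w \<in> V"
  shows "g (us @ tcomb r v s w # zs) = complex_of_real r * g (us @ v # zs) + complex_of_real s * g (us @ w # zs)"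
  using linear[of "us @ v # zs" "length us" v w r s] assms by simp

lemma sets: "u \<in> V \<Longrightarrow> w \<in> V \<Longrightarrow> set (replicate k u @ replicate l w) \<subseteq> V"
  by auto

text \<open>The arguments \<open>zs\<close> left alone are what the induction on \<open>n\<close> needs: it expands one argument at a time and
  moves it there.\<close>

lemma binomial:
  assumes "n + length zs = m" "set zs \<subseteq> V" "u \<in> V" "w \<in> V"
  shows "g (replicate n (tcomb r u s w) @ zs) =
    (\<Sum>k\<le>n. of_nat (n choose k) * complex_of_real r ^ k * complex_of_real s ^ (n - k)
       * g (replicate k u @ replicate (n - k) w @ zs))"
  using assms(1,2)
proof (induction n arbitrary: zs)
  case 0
  then show ?case by simp
next
  case (Suc n)
  define G where "G k = g (replicate k u @ replicate (Suc n - k) w @ zs)" for k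
  define R where "R = complex_of_real r"
  define Z where "Z = complex_of_real s"
  have t: "tcomb r u s w \<in> V" using comb assms by blast
  have split: "g (replicate k u @ replicate (n - k) w @ tcomb r u s w # zs) = R * G (Suc k) + Z * G k"
    if "k \<le> n" for k
  proof -
    have "g (replicate k u @ replicate (n - k) w @ tcomb r u s w # zs)
      = R * g ((replicate k u @ replicate (n - k) w) @ u # zs) + Z * g ((replicate k u @ replicate (n - k) w) @ w # zs)"
      using linear_middle[of "replicate k u @ replicate (n - k) w" zs u w r s, OF _ sets[OF assms(3,4)]]
        Suc.prems assms that
      by (auto simp: R_def Z_def)
    moreover have "g ((replicate k u @ replicate (n - k) w) @ u # zs) = G (Suc k)"
      unfolding G_def by (rule perm) (use Suc.prems assms that in auto)
    moreover have "g ((replicate k u @ replicate (n - k) w) @ w # zs) = G k"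
      unfolding G_def by (rule perm) (use Suc.prems assms that in \<open>auto simp: Suc_diff_le\<close>)
    ultimately show ?thesis by simp
  qed
  have "g (replicate (Suc n) (tcomb r u s w) @ zs) = g (replicate n (tcomb r u s w) @ tcomb r u s w # zs)"
    by (simp add: replicate_app_Cons_same)
  also have "\<dots> = (\<Sum>k\<le>n. of_nat (n choose k) * R ^ k * Z ^ (n - k) * (R * G (Suc k) + Z * G k))"
    using Suc.IH[of "tcomb r u s w # zs"] Suc.prems t by (simp add: split R_def Z_def)
  also have "\<dots> = (\<Sum>k\<le>n. of_nat (n choose k) * R ^ Suc k * Z ^ (n - k) * G (Suc k))
      + (\<Sum>k\<le>n. of_nat (n choose k) * R ^ k * Z ^ (Suc n - k) * G k)"
    unfolding sum.distrib[symmetric]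
    by (intro sum.cong refl) (simp add: Suc_diff_le algebra_simps)
  also have "(\<Sum>k\<le>n. of_nat (n choose k) * R ^ k * Z ^ (Suc n - k) * G k)
      = (\<Sum>k\<le>Suc n. of_nat (n choose k) * R ^ k * Z ^ (Suc n - k) * G k)" by simp
  also have "\<dots> = Z ^ Suc n * G 0 + (\<Sum>k\<le>n. of_nat (n choose Suc k) * R ^ Suc k * Z ^ (n - k) * G (Suc k))"
    by (subst sum.atMost_Suc_shift) simp
  also have "(\<Sum>k\<le>n. of_nat (n choose k) * R ^ Suc k * Z ^ (n - k) * G (Suc k)) + \<dots>
     = Z ^ Suc n * G 0 + (\<Sum>k\<le>n. of_nat (Suc n choose Suc k) * R ^ Suc k * Z ^ (n - k) * G (Suc k))"
    by (simp add: sum.distrib[symmetric] algebra_simps)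
  also have "\<dots> = (\<Sum>k\<le>Suc n. of_nat (Suc n choose k) * R ^ k * Z ^ (Suc n - k) * G k)"
    by (subst sum.atMost_Suc_shift) simp
  finally show ?case by (simp add: G_def R_def Z_def)
qed

text \<open>Replacing \<open>v\<close> by \<open>v + t z\<close> gives a polynomial in the real parameter \<open>t\<close> that vanishes identically;
  its linear coefficient is a multiple of the form with one argument \<open>v\<close> replaced by \<open>z\<close>.\<close>

lemma polarization:
  assumes diag: "\<And>v. v \<in> V \<Longrightarrow> g (replicate m v) = 0"
  shows "n + length zs = m \<Longrightarrow> set zs \<subseteq> V \<Longrightarrow> v \<in> V \<Longrightarrow> g (replicate n v @ zs) = 0"
proof (induction zs arbitrary: n v)
  case Nil
  then show ?case using diag by simp
next
  case (Cons z zs)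
  define c where "c k = of_nat (Suc n choose k) * g (replicate k z @ replicate (Suc n - k) v @ zs)" for k
  have z: "z \<in> V" using Cons.prems by simp
  have root: "(\<Sum>k\<le>Suc n. c k * complex_of_real t ^ k) = 0" for t
  proof -
    have "g (replicate (Suc n) (tcomb t z 1 v) @ zs) = 0"
      by (rule Cons.IH) (use Cons.prems comb in auto)
    then show ?thesis
      using binomial[of "Suc n" zs z v t 1] Cons.prems by (simp add: c_def mult_ac del: sum.atMost_Suc replicate_Suc binomial_Suc_Suc)
  qed
  have "infinite (range complex_of_real)"
    using finite_imageD[of complex_of_real UNIV] infinite_UNIV_char_0 inj_of_real by blast
  moreover have "range complex_of_real \<subseteq> {x. (\<Sum>k\<le>Suc n. c k * x ^ k) = 0}"
    by (rule image_subsetI) (rule CollectI, rule root)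
  ultimately have "infinite {x. (\<Sum>k\<le>Suc n. c k * x ^ k) = 0}"
    using finite_subset by blast
  then have "c 1 = 0" using polyfun_finite_roots[of c "Suc n"] by auto
  then have "of_nat (Suc n) * g (z # replicate n v @ zs) = 0" by (simp add: c_def)
  then have "g (z # replicate n v @ zs) = 0" using of_nat_neq_0 mult_eq_0_iff by blast
  moreover have "g (replicate n v @ z # zs) = g (z # replicate n v @ zs)"
    by (rule perm) (use Cons.prems in auto)
  ultimately show ?case by simp
qed

end

context riemannian_surface
begin

section \<open>Uniqueness from the moments\<close>

lemma symmetric_form_at:
  assumes "sym_tensor_field S m f" "x \<in> points S"
  shows "symmetric_form (tangent_space S x) m (f x)"
proof
  have h: "\<forall>vs. length vs = m \<and> set vs \<subseteq> tangent_space S x \<longrightarrow>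
        (\<forall>i<m. \<forall>v\<in>tangent_space S x. \<forall>w\<in>tangent_space S x. \<forall>r s.
           f x (vs[i := tcomb r v s w]) =
             complex_of_real r * f x (vs[i := v]) + complex_of_real s * f x (vs[i := w])) \<and>
        (\<forall>ws. mset ws = mset vs \<longrightarrow> f x ws = f x vs)"
    using assms unfolding sym_tensor_field_def by blast
  show "f x (vs[i := tcomb r v s w]) = complex_of_real r * f x (vs[i := v]) + complex_of_real s * f x (vs[i := w])"
    if "length vs = m" "set vs \<subseteq> tangent_space S x" "i < m" "v \<in> tangent_space S x" "w \<in> tangent_space S x"
    for vs i v w r s
    using h that by blast
  show "f x ws = f x vs" if "length vs = m" "set vs \<subseteq> tangent_space S x" "mset ws = mset vs" for vs ws
    using h that by blast
qed (rule tcomb_in)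

lemma sym_tensor_field_smooth:
  assumes "sym_tensor_field S m f" "c \<in> atlas S" "length js = m"
  shows "smooth_on (cdom c) (\<lambda>y. f (cpoint c y) (map (\<lambda>i. coord_field S c i y) js))"
proof -
  have "\<forall>c\<in>atlas S. \<forall>js. length js = m \<longrightarrow>
        smooth_on (cdom c) (\<lambda>y. f (cpoint c y) (map (\<lambda>i. coord_field S c i y) js))"
    using assms(1) unfolding sym_tensor_field_def by (elim conjE)
  then show ?thesis using assms(2,3) by blast
qed

text \<open>By the binomial formula the restriction of the tensor is, in a chart, a polynomial in the fiber
  coordinates whose coefficients are components of the tensor field.\<close>

lemma ell_smooth:
  assumes f: "sym_tensor_field S m f"
  shows "smooth_bundle_fun S (ell m f)"
  unfolding smooth_bundle_fun_def
proof
  fix c assume c: "c \<in> atlas S"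
  define b where "b k y = f (cpoint c y) (map (\<lambda>i. coord_field S c i y) (replicate k 1 @ replicate (m - k) 2))" for k y
  define E where "E z = (\<Sum>k\<le>m. of_nat (m choose k) * complex_of_real (snd z $ 1) ^ k
     * complex_of_real (snd z $ 2) ^ (m - k) * b k (fst z))" for z :: "(real^2) \<times> (real^2)"
  have b: "smooth_on (cdom c) (b k)" if "k \<le> m" for k
    unfolding b_def by (rule sym_tensor_field_smooth[OF f c]) (use that in simp)
  have "smooth_on (cdom c \<times> UNIV) E"
    unfolding E_def
    by (intro smooth_on_sum smooth_on_mult smooth_on_const smooth_on_power smooth_on_component
        smooth_on_bounded_linear[OF bounded_linear_of_real] smooth_on_fst b) auto
  then have "smooth_on {(y, \<eta>). y \<in> cdom c \<and> bundle_point S c (y, \<eta>) \<in> unit_bundle S} E"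
    by (rule smooth_on_subset) auto
  then show "smooth_on {(y, \<eta>). y \<in> cdom c \<and> bundle_point S c (y, \<eta>) \<in> unit_bundle S} (ell m f \<circ> bundle_point S c)"
  proof (rule smooth_on_cong, safe)
    fix y \<eta> assume y: "y \<in> cdom c"
    let ?x = "cpoint c y"
    have cx: "c \<in> charts_at S ?x" by (rule cpoint_charts_at[OF c y])
    interpret symmetric_form "tangent_space S ?x" m "f ?x"
      by (rule symmetric_form_at[OF f cpoint_points[OF c y]])
    have e: "coord_field S c i y \<in> tangent_space S ?x" for i by (rule coord_field_in[OF c y])
    have "tvec_of S c ?x \<eta> = tcomb (\<eta> $ 1) (coord_field S c 1 y) (\<eta> $ 2) (coord_field S c 2 y)"
      using coord_decomp[OF cx tvec_of_in[OF cx], of \<eta>] by (simp add: tvec_of_chart[OF cx] chart_cpoint[OF y])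
    then have "ell m f (bundle_point S c (y, \<eta>))
        = f ?x (replicate m (tcomb (\<eta> $ 1) (coord_field S c 1 y) (\<eta> $ 2) (coord_field S c 2 y)) @ [])"
      by (simp add: ell_def bundle_point_def)
    also have "\<dots> = E (y, \<eta>)"
      by (subst binomial) (auto simp: e E_def b_def)
    finally show "E (y, \<eta>) = (ell m f \<circ> bundle_point S c) (y, \<eta>)" by simp
  qed
qed

text \<open>On the circle \<open>cos \<theta> e\<^sub>1 + sin \<theta> e\<^sub>2\<close> the binomial formula gives a homogeneous polynomial of degree \<open>m\<close> in
  \<open>cos \<theta>\<close> and \<open>sin \<theta>\<close>.\<close>

lemma degree_ell:
  assumes f: "sym_tensor_field S m f"
  shows "degree_on_fibers S (int m) (ell m f)"
  unfolding degree_on_fibers_def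
proof (intro conjI ballI allI impI)
  show "smooth_bundle_fun S (ell m f)" by (rule ell_smooth[OF f])
  fix x e1 e2 \<theta>
  assume x: "x \<in> points S" and e: "orthonormal_frame S x e1 e2"
  interpret symmetric_form "tangent_space S x" m "f x"
    by (rule symmetric_form_at[OF f x])
  define h where "h \<theta> = ell m f (x, tcomb (cos \<theta>) e1 (sin \<theta>) e2)" for \<theta>
  have "h = (\<lambda>\<theta>. \<Sum>k\<le>m. of_nat (m choose k) * f x (replicate k e1 @ replicate (m - k) e2)
      * (complex_of_real (cos \<theta>) ^ k * complex_of_real (sin \<theta>) ^ (m - k)))"
  proof
    fix \<theta>
    show "h \<theta> = (\<Sum>k\<le>m. of_nat (m choose k) * f x (replicate k e1 @ replicate (m - k) e2)
      * (complex_of_real (cos \<theta>) ^ k * complex_of_real (sin \<theta>) ^ (m - k)))"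
    using binomial[of m "[]" e1 e2 "cos \<theta>" "sin \<theta>"] e
    by (simp add: h_def ell_def orthonormal_frame_def mult_ac)
  qed
  then have "trig_poly m h"
    by (auto intro!: trig_poly_sum trig_poly_cmult trig_poly_cos_sin)
  then obtain c where c: "\<And>\<theta>. h \<theta> = (\<Sum>j\<in>{- int m..int m}. c j * cis (of_int j * \<theta>))"
    using trig_poly_expansion by blast
  have "fiber_coeff (ell m f) x e1 e2 j = c j" if "j \<in> {- int m..int m}" for j
    using fourier_coefficient[OF c that] by (simp add: fiber_coeff_def h_def)
  then show "ell m f (x, tcomb (cos \<theta>) e1 (sin \<theta>) e2) =
          (\<Sum>j\<in>{- int m..int m}. fiber_coeff (ell m f) x e1 e2 j * cis (of_int j * \<theta>))"
    using c[of \<theta>] by (simp add: h_def)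
qed

lemma sym_tensor_field_diff:
  assumes "sym_tensor_field S m f" "sym_tensor_field S m f'"
  shows "sym_tensor_field S m (\<lambda>x vs. f x vs - f' x vs)"
  unfolding sym_tensor_field_def
proof (intro conjI allI ballI impI)
  fix x vs assume "\<not> (x \<in> points S \<and> length vs = m \<and> set vs \<subseteq> tangent_space S x)"
  then show "f x vs - f' x vs = 0" using assms unfolding sym_tensor_field_def by simp
next
  fix x vs i v w r s
  assume a: "x \<in> points S" "length vs = m \<and> set vs \<subseteq> tangent_space S x" "i < m"
    "v \<in> tangent_space S x" "w \<in> tangent_space S x"
  then show "f x (vs[i := tcomb r v s w]) - f' x (vs[i := tcomb r v s w]) =
      complex_of_real r * (f x (vs[i := v]) - f' x (vs[i := v])) + complex_of_real s * (f x (vs[i := w]) - f' x (vs[i := w]))"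
    using symmetric_form.linear[OF symmetric_form_at[OF assms(1) a(1)]]
      symmetric_form.linear[OF symmetric_form_at[OF assms(2) a(1)]] by (simp add: algebra_simps)
next
  fix x vs ws
  assume a: "x \<in> points S" "length vs = m \<and> set vs \<subseteq> tangent_space S x" "mset ws = mset vs"
  then show "f x ws - f' x ws = f x vs - f' x vs"
    using symmetric_form.perm[OF symmetric_form_at[OF assms(1) a(1)], of vs ws]
      symmetric_form.perm[OF symmetric_form_at[OF assms(2) a(1)], of vs ws] by simp
next
  fix c js assume "c \<in> atlas S" "length (js :: 2 list) = m"
  then show "smooth_on (cdom c) (\<lambda>y. f (cpoint c y) (map (\<lambda>i. coord_field S c i y) js)
      - f' (cpoint c y) (map (\<lambda>i. coord_field S c i y) js))"
    by (intro smooth_on_diff sym_tensor_field_smooth[OF assms(1)] sym_tensor_field_smooth[OF assms(2)])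
qed

text \<open>Additivity of the integral requires integrable summands, and these are continuous along the
  geodesic.\<close>

lemma moment_transform_diff:
  assumes a: "smooth_fun S a" and f: "sym_tensor_field S m f" "sym_tensor_field S m f'"
    and \<xi>: "\<xi> \<in> boundary_bundle S"
  shows "moment_transform S a k m (\<lambda>x vs. f x vs - f' x vs) \<xi> =
    moment_transform S a k m f \<xi> - moment_transform S a k m f' \<xi>"
proof (cases "0 < travel_time S \<xi>")
  case False
  then have "travel_time S \<xi> = 0" using travel_time_nonneg[of \<xi>] by simp
  then show ?thesis by (simp add: moment_transform_def ray_transform_def)
next
  case True
  obtain \<zeta> where m: "maximal_geodesic (travel_time S \<xi>) \<zeta>" and \<zeta>0: "\<zeta> 0 = \<xi>"
    using maximal_geodesic_exists[OF True] by blast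
  have g: "geodesic S (travel_time S \<xi>) \<zeta>" using m by (auto simp: maximal_geodesic_def)
  have u: "\<zeta> 0 \<in> unit_bundle S" using \<xi> \<zeta>0 boundary_bundle_unit by simp
  note int = ray_integrand_integrable[OF a ell_smooth g u]
  show ?thesis
    unfolding moment_transform_def \<zeta>0[symmetric]
    unfolding ray_transform_along_maximal[OF m] integral_diff[OF int[OF f(1)] int[OF f(2)], symmetric]
    by (simp add: ell_def case_prod_beta algebra_simps)
qed

text \<open>Every tangent vector, the zero vector included, is a multiple of a unit vector, so the form vanishes
  on all diagonals.\<close>

lemma tensor_zero_if_ell_zero:
  assumes f: "sym_tensor_field S m f" and zero: "\<And>\<xi>. \<xi> \<in> unit_bundle S \<Longrightarrow> ell m f \<xi> = 0"
  shows "f x vs = 0"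
proof (cases "x \<in> points S \<and> length vs = m \<and> set vs \<subseteq> tangent_space S x")
  case False
  moreover have "\<forall>x vs. \<not> (x \<in> points S \<and> length vs = m \<and> set vs \<subseteq> tangent_space S x) \<longrightarrow> f x vs = 0"
    using f unfolding sym_tensor_field_def by (rule conjunct1)
  ultimately show ?thesis by simp
next
  case True
  interpret symmetric_form "tangent_space S x" m "f x"
    using symmetric_form_at[OF f] True by blast
  obtain c where c: "c \<in> charts_at S x" using charts_at_nonempty True by blast
  have cat: "c \<in> atlas S" "x \<in> fst c" using c charts_at_atlas by blast+
  have unit: "\<exists>r. (x, tvec_of S c x (r *\<^sub>R \<eta>)) \<in> unit_bundle S \<and> r > 0" if "\<eta> \<noteq> 0" for \<eta>
    using normalize_bundle_point(2)[OF cat(1) chart_in_cdom[OF cat(2)] that]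
      coord_norm_sq_pos[OF cat(1) chart_in_cdom[OF cat(2)] that]
    by (intro exI[of _ "inverse (sqrt (coord_norm_sq c (snd c x, \<eta>)))"])
      (simp add: bundle_point_def cpoint_chart[OF cat])
  have diag: "f x (replicate m v) = 0" if v: "v \<in> tangent_space S x" for v
  proof -
    have "\<exists>w t. (x, w) \<in> unit_bundle S \<and> v = tcomb t w 0 w"
    proof (cases "v c = 0")
      case False
      obtain r where r: "(x, tvec_of S c x (r *\<^sub>R v c)) \<in> unit_bundle S" "r > 0" using unit[OF False] by blast
      have "v = tcomb (inverse r) (tvec_of S c x (r *\<^sub>R v c)) 0 (tvec_of S c x (r *\<^sub>R v c))"
        by (rule tangent_eqI[OF c v]) (use r c in \<open>auto simp: tcomb_in tvec_of_in tcomb_chart tvec_of_chart\<close>)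
      then show ?thesis using r by blast
    next
      case True
      obtain r where r: "(x, tvec_of S c x (r *\<^sub>R axis 1 1)) \<in> unit_bundle S"
        using unit[of "axis 1 1"] by auto
      have "v = tcomb 0 (tvec_of S c x (r *\<^sub>R axis 1 1)) 0 (tvec_of S c x (r *\<^sub>R axis 1 1))"
        by (rule tangent_eqI[OF c v]) (use True c in \<open>auto simp: tcomb_in tvec_of_in tcomb_chart\<close>)
      then show ?thesis using r by blast
    qed
    then obtain w t where w: "(x, w) \<in> unit_bundle S" "v = tcomb t w 0 w" by blast
    have "f x (replicate k w @ replicate (m - k) w) = 0" if "k \<le> m" for k
      using zero[OF w(1)] that by (simp add: ell_def flip: replicate_add)
    then show ?thesis
      using binomial[of m "[]" w w t 0] w by (simp add: unit_bundle_def)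
  qed
  have "f x (replicate 0 v @ vs) = 0" if "v \<in> tangent_space S x" for v
    by (rule polarization[OF diag _ _ that]) (use True in auto)
  then show ?thesis using tvec_of_in[OF c] by auto
qed

end

theorem theorem3:
  fixes S :: "'a surface" and a :: "'a \<Rightarrow> complex" and m :: nat
    and f f' :: "'a \<Rightarrow> 'a tvec list \<Rightarrow> complex"
  assumes "compact_riemannian_surface S"
    and "nontrapping S"
    and "strictly_convex_boundary S"
    and "smooth_fun S a"
    and "\<And>k. k \<le> m \<Longrightarrow> s_injective S a k"
    and "sym_tensor_field S m f"
    and "sym_tensor_field S m f'"
    and "\<And>k \<xi>. k \<le> m \<Longrightarrow> \<xi> \<in> influx_bundle S \<Longrightarrow>
           moment_transform S a k m f \<xi> = moment_transform S a k m f' \<xi>"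
  shows "f = f'"
proof -
  interpret riemannian_surface S
    using assms(1) by unfold_locales (auto simp: compact_riemannian_surface_def)
  define h where "h = (\<lambda>x vs. f x vs - f' x vs)"
  have h: "sym_tensor_field S m h"
    unfolding h_def by (rule sym_tensor_field_diff[OF assms(6,7)])
  have moments: "ray_transform S a (\<lambda>\<xi>. complex_of_real (travel_time S \<xi>) ^ j * ell m h \<xi>) \<xi> = 0"
    if "j \<le> m" "\<xi> \<in> influx_bundle S" for j \<xi>
  proof -
    have "\<xi> \<in> boundary_bundle S" using that(2) unfolding influx_bundle_def by blast
    then have "moment_transform S a j m h \<xi> = 0"
      using moment_transform_diff[OF assms(4,6,7)] assms(8)[OF that] by (simp add: h_def)
    then show ?thesis by (simp add: moment_transform_def)
  qed
  have "ell m h \<xi> = 0" if "\<xi> \<in> unit_bundle S" for \<xi>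
    using vanishing_moments[OF assms(4,5) order_refl degree_ell[OF h] moments that] .
  then have "h x vs = 0" for x vs
    using tensor_zero_if_ell_zero[OF h] by blast
  then show ?thesis by (simp add: h_def fun_eq_iff)
qed

end
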